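(* Let $\varPhi$ be the restricted thin plate spline of order $m$, and let $\mathcal{L}$ be a differential operator on $\mathbb{S}^2$ of order $m_0<m-1$. Suppose $K\nu>2+\kappa_m$. For any $p\in[1,\infty]$, if $X_N\subset\mathbb{S}^2$ has fill distance $h$ sufficiently small, then $$\|(\mathbf{M}_{X_N}^{\sharp})^{-1}\|_{p\to p}\le 2\,\|(\mathbf{M}_{X_N})^{-1}\|_{p\to p}.$$ (The right-hand side is understood to be $+\infty$ if $\mathbf{M}_{X_N}$ is not invertible; if $\mathbf{M}_{X_N}$ is invertible, the statement includes that $\mathbf{M}_{X_N}^\sharp$ is invertible.)
   Context: $\mathbb{S}^2$ is the unit sphere in $\mathbb{R}^3$ with geodesic distance $\operatorname{dist}(x,y)=\arccos(x\cdot y)$. $\{Y_\ell^\mu:|\mu|\le\ell\}$ is the standard real $L_2(\mathbb{S}^2)$-orthonormal basis of spherical harmonics of degree $\ell$, and $\Pi_{m-1}=\operatorname{span}\{Y_\ell^\mu:\ell\le m-1,|\mu|\le\ell\}$. A differential operator of order $m_0$ is a linear differential operator with continuous coefficients, so that $\|\mathcal{L}g\|_\infty\le C\|g\|_{C^{m_0}(\mathbb{S}^2)}$. $\|\cdot\|_{p\to p}$ is the operator norm on $\ell_p(X_N)$. For a finite set $X_N=\{x_1,\dots,x_N\}\subset\mathbb{S}^2$: the fill distance is $h=\max_{x\in\mathbb{S}^2}\min_j\operatorname{dist}(x,x_j)$ and the separation radius is $q=\frac12\min_{j\ne k}\operatorname{dist}(x_j,x_k)$. Throughout, point sets are quasi-uniform: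 there is a fixed $\rho_0$ with $h/q\le\rho_0$ for all point sets considered. The restricted thin plate spline of order $m$ ($m\geq 2$ an integer) is $\varPhi(x,y)=\phi(x\cdot y)$ with $\phi(t)=(1-t)^{m-1}\log(1-t)$; up to sign it is conditionally positive definite with respect to $\Pi_{m-1}$. For finite $Z\subset\mathbb{S}^2$ set $S(Z)=\{\sum_{z\in Z}A_z\varPhi(\cdot,z):\sum_zA_zP(z)=0\ \forall P\in\Pi_{m-1}\}+\Pi_{m-1}$. (For $Z$ such that only $0\in\Pi_{m-1}$ vanishes on $Z$, each data vector on $Z$ has a unique interpolant in $S(Z)$; $h$ is taken small enough that this holds for the sets below.) Full Lagrange functions: $\chi_{x_j}\in S(X_N)$ with $\chi_{x_j}(x_k)=\delta_{j,k}$ for all $k$, written $\chi_{x_j}=\sum_{k}A_{j,k}\varPhi(\cdot,x_k)+\sum_{\ell\le m-1}\sum_{|\mu|\le\ell}B_{j,\ell,\mu}Y_\ell^\mu$. Local Lagrange functions: with $K>0$ a fixed constant depending on $m$, let $\Upsilon(x_j)=\{x_k\in X_N:\operatorname{dist}(x_j,x_k)\le Kh|\log h|\}$ and let $b_j\in S(\Upsilon(x_j))\subset S(X_N)$ satisfy $b_j(x_k)=\delta_{j,k}$ for all $x_k\in\Upsilon(x_j)$, written $b_j=\sum_{k}\check A_{j,k}\varPhi(\cdot,x_k)+\sum_{\ell\le m-1}\sum_{|\mu|\le\ell}\check B_{j,\ell,\mu}Y_\ell^\mu$ with $\check A_{j,k}=0$ if $x_k\notin\Upsilon(x_j)$. Constants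 $\nu>0$ (depending only on the kernel) and $\kappa_m$: these are the constants in the known estimates $|A_{j,k}|\le Ch^{2-2m}\exp(-\nu\operatorname{dist}(x_j,x_k)/h)$ and, for all $j$, $\sum_k|A_{j,k}-\check A_{j,k}|\le Ch^{K\nu-\kappa_m}$ and $\sum_{\ell,\mu}|B_{j,\ell,\mu}-\check B_{j,\ell,\mu}|\le Ch^{K\nu-\kappa_m}$. The full FD matrix $\mathbf{M}_{X_N}\in\mathbb{R}^{N\times N}$ has entry $(\mathcal{L}\chi_{x_j})(x_i)$ in row $i$, column $j$; the local FD matrix $\mathbf{M}_{X_N}^\sharp\in\mathbb{R}^{N\times N}$ has entry $(\mathcal{L}b_j)(x_i)$ in row $i$, column $j$. *)

theory Defs
  imports
    "HOL-Analysis.Analysis"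
    "HOL-Computational_Algebra.Polynomial"
    "Jordan_Normal_Form.Gauss_Jordan_Elimination"
begin

no_notation Matrix.vec_index (infixl "$" 100)

text \<open>
  Functions on the sphere are total functions on \<open>real ^ 3\<close> of which only the values on
  \<open>S2\<close> matter.
\<close>

abbreviation S2 :: "(real ^ 3) set" where
  "S2 \<equiv> sphere 0 1"

definition geodist :: "real ^ 3 \<Rightarrow> real ^ 3 \<Rightarrow> real" where
  "geodist x y = arccos (x \<bullet> y)"

text \<open>The supremum is attained, the sphere being compact.\<close>

definition fill_distance :: "(real ^ 3) set \<Rightarrow> real" where
  "fill_distance X = (SUP x\<in>S2. Min (geodist x ` X))"

definition separation_radius :: "(real ^ 3) set \<Rightarrow> real" where
  "separation_radius X = (1/2) * Min {geodist x y | x y. x \<in> X \<and> y \<in> X \<and> x \<noteq> y}"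

text \<open>Two points are required for the separation radius to be meaningful.\<close>

definition quasi_uniform :: "real \<Rightarrow> (real ^ 3) set \<Rightarrow> bool" where
  "quasi_uniform \<rho> X \<longleftrightarrow>
     finite X \<and> X \<subseteq> S2 \<and> card X \<ge> 2 \<and> fill_distance X / separation_radius X \<le> \<rho>"

text \<open>Rodrigues' formula.\<close>

definition legendre :: "nat \<Rightarrow> real poly" where
  "legendre l = Polynomial.smult (1 / (2 ^ l * fact l)) ((pderiv ^^ l) ([:-1, 0, 1:] ^ l))"

text \<open>
  With \<open>y = (sin \<theta> cos \<phi>, sin \<theta> sin \<phi>, cos \<theta>)\<close> and \<open>n = |\<mu>|\<close>, the associated Legendre function
  (without the Condon-Shortley sign) is \<open>sin \<theta> ^ n\<close> times the \<open>n\<close>-th derivative of the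
  Legendre polynomial at \<open>cos \<theta>\<close>, and \<open>(y1 + i y2) ^ n = sin \<theta> ^ n * exp (i n \<phi>)\<close>. So the
  last two factors below are the associated Legendre function times \<open>cos (n \<phi>)\<close>
  or \<open>sin (n \<phi>)\<close>.
\<close>

definition sph_harm :: "nat \<Rightarrow> int \<Rightarrow> real ^ 3 \<Rightarrow> real" where
  "sph_harm l \<mu> y =
     (let n = nat \<bar>\<mu>\<bar>; w = Complex (y $ 1) (y $ 2) ^ n in
      sqrt ((2 * real l + 1) / (4 * pi) * (fact (l - n) / fact (l + n)))
      * (if \<mu> = 0 then 1 else sqrt 2)
      * poly ((pderiv ^^ n) (legendre l)) (y $ 3)
      * (if \<mu> \<ge> 0 then Re w else Im w))"

definition sph_sum :: "nat \<Rightarrow> (nat \<Rightarrow> int \<Rightarrow> real) \<Rightarrow> real ^ 3 \<Rightarrow> real" where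
  "sph_sum n b y = (\<Sum>l\<le>n. \<Sum>\<mu>\<in>{- int l..int l}. b l \<mu> * sph_harm l \<mu> y)"

definition Pi_space :: "nat \<Rightarrow> (real ^ 3 \<Rightarrow> real) set" where
  "Pi_space n = range (sph_sum n)"

text \<open>At \<open>t = 1\<close> this is \<open>0\<close>, the limit, as \<open>m \<ge> 2\<close>.\<close>

definition tps_phi :: "nat \<Rightarrow> real \<Rightarrow> real" where
  "tps_phi m t = (1 - t) ^ (m - 1) * ln (1 - t)"

definition tps :: "nat \<Rightarrow> real ^ 3 \<Rightarrow> real ^ 3 \<Rightarrow> real" where
  "tps m x y = tps_phi m (x \<bullet> y)"

definition spline ::
  "nat \<Rightarrow> (real ^ 3) set \<Rightarrow> (real ^ 3 \<Rightarrow> real) \<Rightarrow> (nat \<Rightarrow> int \<Rightarrow> real) \<Rightarrow> real ^ 3 \<Rightarrow> real" where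
  "spline m Z a b y = (\<Sum>z\<in>Z. a z * tps m y z) + sph_sum (m - 1) b y"

definition moment_conditions :: "nat \<Rightarrow> (real ^ 3) set \<Rightarrow> (real ^ 3 \<Rightarrow> real) \<Rightarrow> bool" where
  "moment_conditions m Z a \<longleftrightarrow> (\<forall>P\<in>Pi_space (m - 1). (\<Sum>z\<in>Z. a z * P z) = 0)"

text \<open>
  The elements of \<open>S(Z)\<close> are exactly the functions \<open>spline m Z a b\<close> whose \<open>a\<close> satisfies the
  moment conditions. The predicate says that this element is the Lagrange function of \<open>S(Z)\<close>
  centred at \<open>x\<close>.
\<close>

definition lagrange_coeffs ::
  "nat \<Rightarrow> (real ^ 3) set \<Rightarrow> real ^ 3 \<Rightarrow> (real ^ 3 \<Rightarrow> real) \<Rightarrow> (nat \<Rightarrow> int \<Rightarrow> real) \<Rightarrow> bool" where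
  "lagrange_coeffs m Z x a b \<longleftrightarrow>
     moment_conditions m Z a \<and> (\<forall>y\<in>Z. spline m Z a b y = (if y = x then 1 else 0))"

text \<open>
  Coefficients are indexed by the points themselves: \<open>A x y\<close> is the coefficient of
  \<open>tps m _ y\<close> in the Lagrange function centred at \<open>x\<close>.
\<close>

definition full_lagrange ::
  "nat \<Rightarrow> (real ^ 3) set \<Rightarrow> (real ^ 3 \<Rightarrow> real ^ 3 \<Rightarrow> real) \<Rightarrow>
   (real ^ 3 \<Rightarrow> nat \<Rightarrow> int \<Rightarrow> real) \<Rightarrow> bool" where
  "full_lagrange m X A B \<longleftrightarrow> (\<forall>x\<in>X. lagrange_coeffs m X x (A x) (B x))"

definition footprint :: "real \<Rightarrow> (real ^ 3) set \<Rightarrow> real ^ 3 \<Rightarrow> (real ^ 3) set" where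
  "footprint K X x =
     {y \<in> X. geodist x y \<le> K * fill_distance X * \<bar>ln (fill_distance X)\<bar>}"

definition local_lagrange ::
  "nat \<Rightarrow> real \<Rightarrow> (real ^ 3) set \<Rightarrow> (real ^ 3 \<Rightarrow> real ^ 3 \<Rightarrow> real) \<Rightarrow>
   (real ^ 3 \<Rightarrow> nat \<Rightarrow> int \<Rightarrow> real) \<Rightarrow> bool" where
  "local_lagrange m K X A B \<longleftrightarrow>
     (\<forall>x\<in>X. lagrange_coeffs m (footprint K X x) x (A x) (B x) \<and>
             (\<forall>y\<in>X - footprint K X x. A x y = 0))"

definition full_coefficient_decay :: "nat \<Rightarrow> real \<Rightarrow> real \<Rightarrow> bool" where
  "full_coefficient_decay m \<rho> \<nu> \<longleftrightarrow>
     (\<exists>C h1. h1 > 0 \<and>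
       (\<forall>X A B. quasi_uniform \<rho> X \<and> fill_distance X \<le> h1 \<and> full_lagrange m X A B \<longrightarrow>
         (\<forall>x\<in>X. \<forall>y\<in>X.
            \<bar>A x y\<bar> \<le> C * fill_distance X powr (2 - 2 * real m)
                       * exp (- \<nu> * geodist x y / fill_distance X))))"

definition local_coefficient_error ::
  "nat \<Rightarrow> real \<Rightarrow> real \<Rightarrow> real \<Rightarrow> real \<Rightarrow> bool" where
  "local_coefficient_error m \<rho> K \<nu> \<kappa> \<longleftrightarrow>
     (\<exists>C h1. h1 > 0 \<and>
       (\<forall>X A B A' B'.
         quasi_uniform \<rho> X \<and> fill_distance X \<le> h1 \<and>
         full_lagrange m X A B \<and> local_lagrange m K X A' B' \<longrightarrow>
         (\<forall>x\<in>X.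
            (\<Sum>y\<in>X. \<bar>A x y - A' x y\<bar>) \<le> C * fill_distance X powr (K * \<nu> - \<kappa>) \<and>
            (\<Sum>l\<le>m - 1. \<Sum>\<mu>\<in>{- int l..int l}. \<bar>B x l \<mu> - B' x l \<mu>\<bar>)
              \<le> C * fill_distance X powr (K * \<nu> - \<kappa>))))"

definition partial :: "2 \<Rightarrow> (real ^ 2 \<Rightarrow> real) \<Rightarrow> real ^ 2 \<Rightarrow> real" where
  "partial i f u = frechet_derivative f (at u) (axis i 1)"

primrec C_k :: "nat \<Rightarrow> (real ^ 2 \<Rightarrow> real) \<Rightarrow> bool" where
  "C_k 0 f \<longleftrightarrow> continuous_on UNIV f"
| "C_k (Suc k) f \<longleftrightarrow> (\<forall>u. f differentiable (at u)) \<and> (\<forall>i. C_k k (partial i f))"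

text \<open>
  Inverse stereographic projection from the north pole (\<open>s = 1\<close>) or the south pole
  (\<open>s = -1\<close>). The two charts form a smooth atlas, so regularity and the form of a differential
  operator need to be tested in these two only.
\<close>

definition stereo :: "real \<Rightarrow> real ^ 2 \<Rightarrow> real ^ 3" where
  "stereo s u =
     (1 / ((norm u)\<^sup>2 + 1)) *\<^sub>R vector [2 * u $ 1, 2 * u $ 2, s * ((norm u)\<^sup>2 - 1)]"

definition C_k_sphere :: "nat \<Rightarrow> (real ^ 3 \<Rightarrow> real) set" where
  "C_k_sphere k = {g. \<forall>s\<in>{1, -1}. C_k k (g \<circ> stereo s)}"

text \<open>
  ``Order \<open>k\<close>'' means order at most \<open>k\<close>: the top order coefficients may vanish.
  The values of \<open>L g\<close> are prescribed only for \<open>g\<close> of class \<open>C^k\<close>, and only on the sphere.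
\<close>

definition differential_operator ::
  "nat \<Rightarrow> ((real ^ 3 \<Rightarrow> real) \<Rightarrow> real ^ 3 \<Rightarrow> real) \<Rightarrow> bool" where
  "differential_operator k L \<longleftrightarrow>
     (\<forall>s\<in>{1, -1}. \<exists>c :: nat \<Rightarrow> nat \<Rightarrow> real ^ 2 \<Rightarrow> real.
        (\<forall>i j. continuous_on UNIV (c i j)) \<and>
        (\<forall>g\<in>C_k_sphere k. \<forall>u.
           L g (stereo s u) =
             (\<Sum>i\<le>k. \<Sum>j\<le>k - i.
                c i j u * (partial 1 ^^ i) ((partial 2 ^^ j) (g \<circ> stereo s)) u)))"

text \<open>
  \<open>xs\<close> enumerates the points and \<open>f x\<close> is the Lagrange-type function centred at \<open>x\<close>.
\<close>

definition fd_matrix ::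
  "((real ^ 3 \<Rightarrow> real) \<Rightarrow> real ^ 3 \<Rightarrow> real) \<Rightarrow> (real ^ 3) list \<Rightarrow>
   (real ^ 3 \<Rightarrow> real ^ 3 \<Rightarrow> real) \<Rightarrow> real Matrix.mat" where
  "fd_matrix L xs f =
     Matrix.mat (length xs) (length xs) (\<lambda>(i, j). L (f (xs ! j)) (xs ! i))"

definition lp_norm :: "ereal \<Rightarrow> real Matrix.vec \<Rightarrow> real" where
  "lp_norm p v =
     (if p = \<infinity> then Max (insert 0 ((\<lambda>i. \<bar>vec_index v i\<bar>) ` {..<dim_vec v}))
      else (\<Sum>i<dim_vec v. \<bar>vec_index v i\<bar> powr real_of_ereal p) powr (1 / real_of_ereal p))"

definition lp_opnorm :: "ereal \<Rightarrow> real Matrix.mat \<Rightarrow> real" where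
  "lp_opnorm p M =
     (SUP v\<in>{v \<in> carrier_vec (dim_col M). lp_norm p v \<le> 1}. lp_norm p (M *\<^sub>v v))"

text \<open>For an invertible matrix \<open>mat_inverse\<close> returns \<open>Some\<close> of the inverse.\<close>

definition inverse_mat :: "real Matrix.mat \<Rightarrow> real Matrix.mat" where
  "inverse_mat M = the (mat_inverse M)"

end

theory Submission
  imports
    Defs
    "HOL-Real_Asymp.Real_Asymp"
    "Jordan_Normal_Form.Determinant"
begin

no_notation Matrix.vec_index (infixl "$" 100)
no_notation Matrix.scalar_prod (infix "\<bullet>" 70)

text \<open>
  A local Lagrange function \<open>b\<^sub>j\<close> lies in the full spline space, hence
  \<open>b\<^sub>j = (\<Sum>k. b\<^sub>j x\<^sub>k * \<chi>\<^sub>k)\<close> on the sphere. Applying the operator shows that the local matrix is the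
  full matrix times the matrix \<open>B\<close> with entries \<open>b\<^sub>j x\<^sub>k\<close>. As kernel and spherical harmonics are
  bounded, the entries of \<open>B\<close> differ from those of the identity by at most a constant times
  \<open>h powr (K * \<nu> - \<kappa>)\<close>. By quasi-uniformity there are at most a constant times \<open>h powr -2\<close> points,
  so \<open>B\<close> is within \<open>1/2\<close> of the identity in row and column sums, whence the norm of its inverse is
  at most \<open>2\<close>.
\<close>

section \<open>Distances and point counts on the sphere\<close>

text \<open>The expansion of \<open>b\<^sub>j\<close> in the functions \<open>\<chi>\<^sub>k\<close>
  rests on uniqueness of interpolation, while what is given is the existence of Lagrange functions.
  Symmetry of the kernel turns existence into uniqueness of the kernel coefficients. What is left is
  a combination of spherical harmonics vanishing at the nodes, and a small fill distance forces it
  to vanish on the sphere. Applying the operator term by term requires splines in its domain: in the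
  charts the kernel is \<open>m - 2\<close> times continuously differentiable, which is where the
  order below \<open>m - 1\<close> enters.

  The factorisation makes the error multiplicative: \<open>b\<^sub>j - \<chi>\<^sub>j\<close> is
  measured by its values at the nodes alone, and the inverse of the full matrix enters as a factor.
  All \<open>p\<close> are treated at once by keeping the entrywise bound \<open>1 / (2 * n)\<close>
  on \<open>B\<close> minus the identity: it bounds each entry of \<open>w\<close> by the same entry
  of \<open>B w\<close> plus the mean of the entries of \<open>B w\<close>, all in modulus, and
  convexity of the power function does the rest.\<close>

lemma S2_inner_bounds: "x \<in> S2 \<Longrightarrow> y \<in> S2 \<Longrightarrow> - 1 \<le> x \<bullet> y \<and> x \<bullet> y \<le> 1"
  using Cauchy_Schwarz_ineq2[of x y] by (simp add: abs_le_iff)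

lemma geodist_bounds:
  assumes "x \<in> S2" "y \<in> S2"
  shows "0 \<le> geodist x y" "geodist x y \<le> pi" "cos (geodist x y) = x \<bullet> y"
  using arccos[of "x \<bullet> y"] S2_inner_bounds[OF assms] by (auto simp: geodist_def)

lemma chord_eq:
  assumes "x \<in> S2" "y \<in> S2"
  shows "dist x y = 2 * sin (geodist x y / 2)"
proof -
  have "(dist x y)\<^sup>2 = 2 - 2 * cos (geodist x y)"
    using assms dot_norm_neg[of x y] by (simp add: geodist_bounds dist_norm)
  also have "\<dots> = (2 * sin (geodist x y / 2))\<^sup>2"
    using cos_double_sin[of "geodist x y / 2"] by simp
  finally show ?thesis
  proof (rule power2_eq_imp_eq)
    show "0 \<le> 2 * sin (geodist x y / 2)"
      using geodist_bounds(1,2)[OF assms] by (auto intro!: sin_ge_zero)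
  qed simp
qed

lemma dist_le_geodist: "x \<in> S2 \<Longrightarrow> y \<in> S2 \<Longrightarrow> dist x y \<le> geodist x y"
  using chord_eq[of x y] geodist_bounds[of x y] sin_x_le_x[of "geodist x y / 2"] by simp

lemma geodist_pos: "x \<in> S2 \<Longrightarrow> y \<in> S2 \<Longrightarrow> x \<noteq> y \<Longrightarrow> 0 < geodist x y"
  using dist_le_geodist[of x y] by (simp add: less_le_trans[of _ "dist x y"])

text \<open>With \<open>t\<close> half the geodesic distance, \<open>t \<le> 1.6\<close> gives
  \<open>t\<^sup>2 \<le> 3\<close>, so \<open>sin t \<ge> t - t ^ 3 / 6 \<ge> t / 2\<close>, and the
  chord is \<open>2 * sin t\<close>. The factor 2 is later offset by the one in the separation
  radius: distinct points have chordal distance at least \<open>separation_radius X\<close>.\<close>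

lemma geodist_le_2_dist:
  assumes "x \<in> S2" "y \<in> S2"
  shows "geodist x y \<le> 2 * dist x y"
proof -
  define t where "t = geodist x y / 2"
  have t: "0 \<le> t" "t \<le> 1.6"
    using geodist_bounds[OF assms] pi_approx by (auto simp: t_def)
  have "\<bar>sin t - (\<Sum>m<3. sin_coeff m * t ^ m)\<bar> \<le> inverse (fact 3) * \<bar>t\<bar> ^ 3"
    by (rule Maclaurin_sin_bound)
  then have "\<bar>sin t - t\<bar> \<le> t ^ 3 / 6"
    using t by (simp add: sin_coeff_def eval_nat_numeral field_simps)
  then have "t - t ^ 3 / 6 \<le> sin t" by linarith
  moreover have "t ^ 3 \<le> t * 3"
  proof -
    have "t * t\<^sup>2 \<le> t * 1.6\<^sup>2" using t by (intro mult_left_mono power_mono) auto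
    also have "\<dots> \<le> t * 3" using t by (intro mult_left_mono) (auto simp: power2_eq_square)
    finally show ?thesis by (simp add: eval_nat_numeral)
  qed
  ultimately show ?thesis using chord_eq[OF assms] by (simp add: t_def)
qed

text \<open>
  The balls of radius \<open>d / 2\<close> around the points are disjoint and lie in a shell of thickness \<open>d\<close>
  around the sphere; compare volumes.
\<close>

lemma packing_bound:
  fixes X :: "(real ^ 3) set" and d :: real
  assumes X: "finite X" "X \<subseteq> S2" and d: "0 < d" "d \<le> 2"
    and sep: "\<And>x y. x \<in> X \<Longrightarrow> y \<in> X \<Longrightarrow> x \<noteq> y \<Longrightarrow> d \<le> dist x y"
  shows "real (card X) * d\<^sup>2 \<le> 32"
proof -
  define r where "r = d / 2"
  have r: "0 < r" "r \<le> 1" using d by (auto simp: r_def)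
  define V where "V = measure lborel (ball (0 :: real ^ 3) 1)"
  have V: "V > 0" unfolding V_def by (rule content_ball_pos) simp
  have ball: "measure lborel (ball (c :: real ^ 3) s) = s ^ 3 * V" if "s \<ge> 0" for c s
    using content_ball_conv_unit_ball[OF that, of c] by (simp add: V_def)
  have bf: "ball (c :: real ^ 3) s \<in> fmeasurable lborel" for c s
    by (intro fmeasurableI emeasure_lborel_ball_finite) simp
  define U where "U = (\<Union>x\<in>X. ball x r)"
  have disj: "disjoint_family_on (\<lambda>x. ball x r) X"
  proof (clarsimp simp: disjoint_family_on_def disjoint_iff)
    fix x y z assume "x \<in> X" "y \<in> X" "x \<noteq> y" "dist x z < r" "dist y z < r"
    then show False using sep[of x y] dist_triangle2[of x y z] by (simp add: r_def)
  qed
  have U: "measure lborel U = real (card X) * (r ^ 3 * V)"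
    unfolding U_def using X r disj
    by (subst measure_finite_Union) (auto simp: ball fmeasurableD2[OF bf])
  have Uf: "U \<in> fmeasurable lborel"
    unfolding U_def using X bf by (intro fmeasurable.finite_UN)
  have inner: "U \<inter> ball 0 (1 - r) = {}"
  proof -
    have False if "x \<in> X" "dist x z < r" "norm z < 1 - r" for x z
    proof -
      have "norm x = 1" using that X by auto
      then show False
        using that norm_triangle_sub[of x z] by (simp add: dist_norm)
    qed
    then show ?thesis by (auto simp: U_def)
  qed
  have sub: "U \<union> ball 0 (1 - r) \<subseteq> ball 0 (1 + r)"
  proof -
    have "norm z < 1 + r" if "x \<in> X" "dist x z < r" for x z
    proof -
      have "norm x = 1" using that X by auto
      then show ?thesis
        using that norm_triangle_sub[of z x] by (simp add: dist_norm norm_minus_commute)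
    qed
    then show ?thesis using r by (auto simp: U_def)
  qed
  have "real (card X) * (r ^ 3 * V) + (1 - r) ^ 3 * V = measure lborel (U \<union> ball 0 (1 - r))"
    using measure_Un_AE[OF _ Uf bf, of 0 "1 - r"] inner U r
    by (simp add: ball disjoint_iff)
  also have "\<dots> \<le> (1 + r) ^ 3 * V"
    using measure_mono_fmeasurable[OF sub fmeasurableD[OF fmeasurable.Un[OF Uf bf]] bf] ball[of "1 + r" 0] r
    by simp
  finally have "(real (card X) * r ^ 3 + (1 - r) ^ 3) * V \<le> (1 + r) ^ 3 * V"
    by (simp add: algebra_simps)
  then have "real (card X) * r ^ 3 + (1 - r) ^ 3 \<le> (1 + r) ^ 3"
    using V by simp
  \<comment> \<open>The shell has volume
    \<open>(1 + r) ^ 3 - (1 - r) ^ 3 = 6 * r + 2 * r ^ 3\<close> times \<open>V\<close>, of first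
    order in \<open>r\<close>. Comparison with a full ball would only give a count of order
    \<open>r powr -3\<close>.\<close>
  then have "(real (card X) * r\<^sup>2) * r \<le> (6 + 2 * r\<^sup>2) * r"
    by (simp add: eval_nat_numeral algebra_simps)
  then have "real (card X) * r\<^sup>2 \<le> 6 + 2 * r\<^sup>2" using r by simp
  also have "\<dots> \<le> 8" using r power_le_one[of r 2] by simp
  finally show ?thesis by (simp add: r_def power_divide)
qed

text \<open>A finite connected set has at most one point, but the sphere contains antipodal points.
  This provides a point of the sphere off any finite set and so a positive fill distance.\<close>

lemma infinite_S2: "infinite S2"
proof
  assume "finite S2"
  moreover have "connected S2" by (rule connected_sphere) simp
  ultimately obtain a where "S2 = {a}"
    using connected_finite_iff_sing[of S2] by fastforce
  moreover have "axis 1 1 \<in> S2" "- axis 1 1 \<in> S2" by (auto simp: norm_axis_1)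
  ultimately have "axis 1 1 \<in> {a}" "- axis 1 1 \<in> {a}" by (simp_all only:)
  then have "axis 1 1 = - (axis 1 1 :: real ^ 3)" by simp
  from arg_cong[OF this, of "\<lambda>v. v $ 1"] show False by (simp add: axis_def)
qed

section \<open>Fill distance and separation radius of a finite set\<close>

context
  fixes X :: "(real ^ 3) set"
  assumes X: "finite X" "X \<noteq> {}" "X \<subseteq> S2"
begin

text \<open>Geodesic distances are at most \<open>pi\<close>, so the supremum in
  \<open>fill_distance\<close> is taken over a bounded set and is an upper bound.\<close>

lemma Min_geodist_le_fill_distance:
  assumes "x \<in> S2"
  shows "Min (geodist x ` X) \<le> fill_distance X"
proof -
  obtain y where y: "y \<in> X" using X by auto
  have "Min (geodist x ` X) \<le> pi" if "x \<in> S2" for x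
    using Min_le[of "geodist x ` X" "geodist x y"] geodist_bounds(2)[OF that subsetD[OF X(3) y]] y X(1)
    by (meson finite_imageI imageI order_trans)
  then show ?thesis
    unfolding fill_distance_def using assms by (intro cSUP_upper) (auto intro!: bdd_aboveI2)
qed

lemma fill_distance_dense:
  assumes "x \<in> S2"
  obtains y where "y \<in> X" "geodist x y \<le> fill_distance X"
proof -
  have "Min (geodist x ` X) \<in> geodist x ` X" using X(1,2) by (intro Min_in) auto
  then show ?thesis using Min_geodist_le_fill_distance[OF assms] that by auto
qed

lemma fill_distance_pos: "0 < fill_distance X"
proof -
  have "\<not> S2 \<subseteq> X" using X infinite_S2 finite_subset by auto
  then obtain x where x: "x \<in> S2" "x \<notin> X" by blast
  have "0 < Min (geodist x ` X)"
    using X(1,2) x geodist_pos[OF x(1) subsetD[OF X(3)]] by (subst Min_gr_iff) auto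
  then show ?thesis using Min_geodist_le_fill_distance[OF x(1)] by simp
qed

lemma finite_distances: "finite {geodist x y | x y. x \<in> X \<and> y \<in> X \<and> x \<noteq> y}"
proof (rule finite_subset)
  show "{geodist x y | x y. x \<in> X \<and> y \<in> X \<and> x \<noteq> y} \<subseteq> (\<lambda>(x, y). geodist x y) ` (X \<times> X)" by auto
qed (use X in auto)

lemma separation_radius_le:
  "x \<in> X \<Longrightarrow> y \<in> X \<Longrightarrow> x \<noteq> y \<Longrightarrow> 2 * separation_radius X \<le> geodist x y"
  unfolding separation_radius_def using Min_le[OF finite_distances, of "geodist x y"] by auto

lemma separation_radius_pos:
  assumes "card X \<ge> 2"
  shows "0 < separation_radius X"
proof -
  obtain x y where xy: "x \<in> X" "y \<in> X" "x \<noteq> y"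
    using assms card_le_Suc0_iff_eq[OF X(1)] by auto
  have "Min {geodist x y | x y. x \<in> X \<and> y \<in> X \<and> x \<noteq> y} \<in> {geodist x y | x y. x \<in> X \<and> y \<in> X \<and> x \<noteq> y}"
    using xy by (intro Min_in finite_distances) blast
  then obtain a b where "a \<in> X" "b \<in> X" "a \<noteq> b"
    "Min {geodist x y | x y. x \<in> X \<and> y \<in> X \<and> x \<noteq> y} = geodist a b" by blast
  then show ?thesis
    unfolding separation_radius_def using geodist_pos[OF subsetD[OF X(3)] subsetD[OF X(3)], of a b] by simp
qed

end

text \<open>Points are at least \<open>q\<close> apart in chordal distance, so packing gives
  \<open>N * q\<^sup>2 \<le> 32\<close>; quasi-uniformity, as \<open>h \<le> \<rho> * q\<close>,
  trades \<open>q\<close> for \<open>h\<close>.\<close>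

lemma card_le_fill_distance:
  assumes "quasi_uniform \<rho> X"
  shows "real (card X) * (fill_distance X)\<^sup>2 \<le> 32 * \<rho>\<^sup>2"
proof -
  have X: "finite X" "X \<noteq> {}" "X \<subseteq> S2" "card X \<ge> 2"
    using assms by (auto simp: quasi_uniform_def)
  define h q where "h = fill_distance X" and "q = separation_radius X"
  have h: "0 < h" using fill_distance_pos[OF X(1-3)] by (simp add: h_def)
  have q: "0 < q" using separation_radius_pos[OF X] by (simp add: q_def)
  have sep: "q \<le> dist x y" if "x \<in> X" "y \<in> X" "x \<noteq> y" for x y
    using separation_radius_le[OF X(1-3) that] geodist_le_2_dist[OF subsetD[OF X(3)] subsetD[OF X(3)], of x y] that
    by (simp add: q_def)
  obtain x y where xy: "x \<in> X" "y \<in> X" "x \<noteq> y"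
    using X(4) card_le_Suc0_iff_eq[OF X(1)] by auto
  have "dist x y \<le> 2"
    using subsetD[OF X(3) xy(1)] subsetD[OF X(3) xy(2)] norm_triangle_ineq4[of x y] by (simp add: dist_norm)
  then have "q \<le> 2" using sep[OF xy] by simp
  with packing_bound[OF X(1,3) q] sep have *: "real (card X) * q\<^sup>2 \<le> 32" by blast
  have "h \<le> \<rho> * q" using assms q by (simp add: quasi_uniform_def h_def q_def divide_le_eq)
  then have "h\<^sup>2 \<le> (\<rho> * q)\<^sup>2" using h by (intro power_mono) auto
  then have "real (card X) * h\<^sup>2 \<le> real (card X) * (\<rho>\<^sup>2 * q\<^sup>2)"
    by (simp add: mult_left_mono power_mult_distrib)
  also have "\<dots> = (real (card X) * q\<^sup>2) * \<rho>\<^sup>2" by simp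
  also have "\<dots> \<le> 32 * \<rho>\<^sup>2" using * by (intro mult_right_mono) auto
  finally show ?thesis by (simp add: h_def)
qed

section \<open>Unisolvence of dense point sets\<close>

text \<open>
  Adding a function to the family either needs no new node, or its residual is nonzero at some
  point, which becomes the new node, and the old cardinal functions are corrected by the residual.
\<close>

lemma finite_family_representation:
  fixes f :: "'i \<Rightarrow> 'a::topological_space \<Rightarrow> real"
  assumes "finite I" "\<And>i. i \<in> I \<Longrightarrow> continuous_on S (f i)"
  shows "\<exists>(k::nat) y \<phi>. (\<forall>j<k. y j \<in> S \<and> continuous_on S (\<phi> j)) \<and>
    (\<forall>i\<in>I. \<forall>x\<in>S. f i x = (\<Sum>j<k. f i (y j) * \<phi> j x))"
  using assms
proof (induction I)
  case empty
  then show ?case by (intro exI[of _ 0]) auto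
next
  case (insert g I)
  then obtain k y \<phi> where
    yp: "\<And>j. j < k \<Longrightarrow> y j \<in> S" "\<And>j. j < k \<Longrightarrow> continuous_on S (\<phi> j)"
    and rep: "\<And>i x. i \<in> I \<Longrightarrow> x \<in> S \<Longrightarrow> f i x = (\<Sum>j<(k::nat). f i (y j) * \<phi> j x)"
    by (metis insertCI)
  define r where "r x = f g x - (\<Sum>j<k. f g (y j) * \<phi> j x)" for x
  have contr: "continuous_on S r"
    unfolding r_def using yp insert.prems by (intro continuous_intros) auto
  show ?case
  proof (cases "\<forall>x\<in>S. r x = 0")
    case True
    then show ?thesis using yp rep
      by (intro exI[of _ k] exI[of _ y] exI[of _ \<phi>]) (auto simp: r_def)
  next
    case False
    then obtain z where z: "z \<in> S" "r z \<noteq> 0" by auto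
    define y' where "y' j = (if j < k then y j else z)" for j
    define \<phi>' where "\<phi>' j x = (if j < k then \<phi> j x - \<phi> j z * (r x / r z) else r x / r z)" for j x
    have sum: "(\<Sum>j<Suc k. h (y' j) * \<phi>' j x) =
        (\<Sum>j<k. h (y j) * \<phi> j x) + (h z - (\<Sum>j<k. h (y j) * \<phi> j z)) * (r x / r z)" for h x
      by (simp add: y'_def \<phi>'_def algebra_simps sum_subtractf sum_distrib_left)
    have "f i x = (\<Sum>j<Suc k. f i (y' j) * \<phi>' j x)" if "i \<in> insert g I" "x \<in> S" for i x
    proof (cases "i = g")
      case True
      then show ?thesis unfolding sum using z by (simp flip: r_def) (simp add: r_def)
    next
      case False
      then show ?thesis unfolding sum using that z rep by simp
    qed
    moreover have "y' j \<in> S \<and> continuous_on S (\<phi>' j)" if "j < Suc k" for j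
    proof
      show "y' j \<in> S" using that yp z by (auto simp: y'_def)
      show "continuous_on S (\<phi>' j)"
        using yp contr z by (cases "j < k") (auto simp: \<phi>'_def intro!: continuous_intros)
    qed
    ultimately show ?thesis by blast
  qed
qed

text \<open>
  Whatever the coefficients, the modulus of continuity of a member of the span is at most its
  maximum times the sum of those of the finitely many functions representing the span. Hence a
  member is at least half its maximum near a maximum point.
\<close>

lemma unisolvent_dense_sets:
  fixes f :: "'i \<Rightarrow> 'a::metric_space \<Rightarrow> real"
  assumes S: "compact S" and I: "finite I" and cont: "\<And>i. i \<in> I \<Longrightarrow> continuous_on S (f i)"
  shows "\<exists>\<delta>>0. \<forall>X c. X \<subseteq> S \<and> (\<forall>x\<in>S. \<exists>y\<in>X. dist x y < \<delta>) \<and>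
     (\<forall>y\<in>X. (\<Sum>i\<in>I. c i * f i y) = 0) \<longrightarrow> (\<forall>x\<in>S. (\<Sum>i\<in>I. c i * f i x) = 0)"
proof -
  from finite_family_representation[of I S f, OF I cont] obtain k y \<phi> where
    yp: "\<And>j. j < k \<Longrightarrow> y j \<in> S" "\<And>j. j < k \<Longrightarrow> continuous_on S (\<phi> j)"
    and rep: "\<And>i x. i \<in> I \<Longrightarrow> x \<in> S \<Longrightarrow> f i x = (\<Sum>j<(k::nat). f i (y j) * \<phi> j x)"
    by metis
  \<comment> \<open>The tolerance lets \<open>k\<close> such terms add up to at most one half;
    \<open>real k + 1\<close> avoids a division by zero for \<open>k = 0\<close>.\<close>
  have "\<exists>d>0. \<forall>x\<in>S. \<forall>x'\<in>S. dist x x' < d \<longrightarrow> \<bar>\<phi> j x - \<phi> j x'\<bar> < 1 / (2 * (real k + 1))"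
    if "j < k" for j
  proof -
    have "uniformly_continuous_on S (\<phi> j)"
      using compact_uniformly_continuous[OF yp(2)[OF that] S] .
    then show ?thesis
        unfolding uniformly_continuous_on_def dist_real_def
      by (elim allE[of _ "1 / (2 * (real k + 1))"]) (auto simp: dist_commute abs_minus_commute)
  qed
  then obtain d where d: "\<And>j. j < k \<Longrightarrow> d j > 0"
    "\<And>j x x'. j < k \<Longrightarrow> x \<in> S \<Longrightarrow> x' \<in> S \<Longrightarrow> dist x x' < d j \<Longrightarrow> \<bar>\<phi> j x - \<phi> j x'\<bar> < 1 / (2 * (real k + 1))"
    by metis
  \<comment> \<open>The element \<open>1\<close> keeps the set nonempty when
    \<open>k = 0\<close>.\<close>
  define \<delta> where "\<delta> = Min (insert 1 (d ` {..<k}))"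
  have \<delta>: "\<delta> > 0" "\<And>j. j < k \<Longrightarrow> \<delta> \<le> d j"
    using d(1) by (auto simp: \<delta>_def intro!: Min_le)
  show ?thesis
  proof (intro exI[of _ \<delta>] conjI allI impI ballI \<delta>(1))
    fix X c x
    assume X: "X \<subseteq> S \<and> (\<forall>x\<in>S. \<exists>y\<in>X. dist x y < \<delta>) \<and> (\<forall>y\<in>X. (\<Sum>i\<in>I. c i * f i y) = 0)"
      and x: "x \<in> S"
    define g where "g x = (\<Sum>i\<in>I. c i * f i x)" for x
    have grep: "g x = (\<Sum>j<k. g (y j) * \<phi> j x)" if "x \<in> S" for x
    proof -
      have "g x = (\<Sum>i\<in>I. \<Sum>j<k. c i * f i (y j) * \<phi> j x)"
        unfolding g_def using rep that by (simp add: sum_distrib_left mult.assoc)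
      also have "\<dots> = (\<Sum>j<k. \<Sum>i\<in>I. c i * f i (y j) * \<phi> j x)" by (rule sum.swap)
      finally show ?thesis by (simp add: g_def sum_distrib_right)
    qed
    have "continuous_on S (\<lambda>x. \<bar>g x\<bar>)"
      unfolding g_def using cont by (intro continuous_intros) auto
    from continuous_attains_sup[OF S _ this] x obtain x0 where
      x0: "x0 \<in> S" "\<And>x. x \<in> S \<Longrightarrow> \<bar>g x\<bar> \<le> \<bar>g x0\<bar>" by blast
    obtain z where z: "z \<in> X" "dist x0 z < \<delta>" using X x0 by blast
    have zS: "z \<in> S" "g z = 0" using X z by (auto simp: g_def)
    have "g x0 = g x0 - g z" using zS by simp
    also have "\<dots> = (\<Sum>j<k. g (y j) * (\<phi> j x0 - \<phi> j z))"
      unfolding grep[OF x0(1)] grep[OF zS(1)] by (simp add: algebra_simps sum_subtractf)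
    also have "\<bar>\<dots>\<bar> \<le> (\<Sum>j<k. \<bar>g x0\<bar> * (1 / (2 * (real k + 1))))"
    proof (rule order_trans[OF sum_abs sum_mono])
      fix j assume "j \<in> {..<k}"
      then have j: "j < k" by simp
      have "\<bar>\<phi> j x0 - \<phi> j z\<bar> \<le> 1 / (2 * (real k + 1))"
        using d(2)[OF j x0(1) zS(1)] z \<delta>(2)[OF j] by linarith
      then show "\<bar>g (y j) * (\<phi> j x0 - \<phi> j z)\<bar> \<le> \<bar>g x0\<bar> * (1 / (2 * (real k + 1)))"
        unfolding abs_mult using x0(2)[OF yp(1)[OF j]] by (intro mult_mono) auto
    qed
    also have "\<dots> = \<bar>g x0\<bar> * (real k / (2 * (real k + 1)))" by simp
    also have "\<dots> \<le> \<bar>g x0\<bar> * (1 / 2)"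
      by (intro mult_left_mono) (auto simp: field_simps)
    finally have "g x0 = 0" by simp
    then show "(\<Sum>i\<in>I. c i * f i x) = 0" using x0(2)[OF x] by (simp add: g_def)
  qed
qed

lemma continuous_on_sph_harm: "continuous_on S (sph_harm l \<mu>)"
proof -
  have w: "continuous_on S (\<lambda>y::real^3. Complex (y $ 1) (y $ 2) ^ n)" for n
    unfolding Complex_eq by (intro continuous_intros)
  show ?thesis
    unfolding sph_harm_def Let_def
    by (cases "\<mu> \<ge> 0") (auto intro!: continuous_intros w)
qed

lemma sph_sum_conv_Sigma:
  "sph_sum n b y = (\<Sum>i\<in>(SIGMA l:{..n}. {- int l..int l}). b (fst i) (snd i) * sph_harm (fst i) (snd i) y)"
  unfolding sph_sum_def by (subst sum.Sigma) (auto simp: case_prod_beta)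

text \<open>Chordal distance is at most geodesic distance, so a small fill distance makes
  \<open>X\<close> dense in the sense of \<open>unisolvent_dense_sets\<close>. The threshold depends
  on \<open>n\<close> alone, and the conclusion concerns the function rather than its
  coefficients.\<close>

lemma sph_sum_unisolvent:
  "\<exists>\<delta>>0. \<forall>X b. finite X \<and> X \<noteq> {} \<and> X \<subseteq> S2 \<and> fill_distance X < \<delta> \<and> (\<forall>y\<in>X. sph_sum n b y = 0)
     \<longrightarrow> (\<forall>y\<in>S2. sph_sum n b y = 0)"
proof -
  obtain \<delta> where \<delta>: "\<delta> > 0" and *: "\<And>X c. X \<subseteq> S2 \<Longrightarrow> \<forall>x\<in>S2. \<exists>y\<in>X. dist x y < \<delta> \<Longrightarrow>
     \<forall>y\<in>X. (\<Sum>i\<in>(SIGMA l:{..n}. {- int l..int l}). c i * sph_harm (fst i) (snd i) y) = 0 \<Longrightarrow>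
     \<forall>x\<in>S2. (\<Sum>i\<in>(SIGMA l:{..n}. {- int l..int l}). c i * sph_harm (fst i) (snd i) x) = 0"
    using unisolvent_dense_sets[of S2 "SIGMA l:{..n}. {- int l..int l}" "\<lambda>i. sph_harm (fst i) (snd i)"]
    by (auto simp: continuous_on_sph_harm)
  show ?thesis
  proof (intro exI[of _ \<delta>] conjI allI impI \<delta>)
    fix X b
    assume X: "finite X \<and> X \<noteq> {} \<and> X \<subseteq> S2 \<and> fill_distance X < \<delta> \<and> (\<forall>y\<in>X. sph_sum n b y = 0)"
    have "\<exists>y\<in>X. dist x y < \<delta>" if x: "x \<in> S2" for x
    proof -
      obtain y where "y \<in> X" "geodist x y \<le> fill_distance X"
        using fill_distance_dense X x by metis
      moreover have "dist x y \<le> geodist x y" if "y \<in> X" for y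
        using dist_le_geodist x X that by blast
      ultimately show ?thesis using X by fastforce
    qed
    then show "\<forall>y\<in>S2. sph_sum n b y = 0"
      using *[of X "\<lambda>i. b (fst i) (snd i)"] X by (simp add: sph_sum_conv_Sigma)
  qed
qed

section \<open>Regularity of splines\<close>

lemma partial_eq:
  assumes "(f has_derivative f') (at u)"
  shows "partial i f u = f' (axis i 1)"
  using frechet_derivative_at[OF assms] by (simp add: partial_def)

lemma partial_const [simp]: "partial i (\<lambda>u. c) = (\<lambda>u. 0)"
  by (rule ext, subst partial_eq[where f' = "\<lambda>_. 0"]) auto

lemma partial_nth [simp]: "partial i (\<lambda>u. u $ j) = (\<lambda>u. if i = j then 1 else 0)"
proof
  fix u :: "real ^ 2"
  have "((\<lambda>u. u $ j) has_derivative (\<lambda>h. h $ j)) (at u)"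
    by (rule bounded_linear_imp_has_derivative) (rule bounded_linear_vec_nth)
  from partial_eq[OF this] show "partial i (\<lambda>u. u $ j) u = (if i = j then 1 else 0)"
    by (simp add: axis_def)
qed

lemma has_derivative_frechet:
  "f differentiable (at u) \<Longrightarrow> (f has_derivative frechet_derivative f (at u)) (at u)"
  by (simp add: frechet_derivative_works)

lemma partial_add:
  assumes "f differentiable (at u)" "g differentiable (at u)"
  shows "partial i (\<lambda>u. f u + g u) u = partial i f u + partial i g u"
  using partial_eq[OF has_derivative_add[OF assms[THEN has_derivative_frechet]]]
  by (simp add: partial_def)

lemma partial_mult:
  assumes "f differentiable (at u)" "g differentiable (at u)"
  shows "partial i (\<lambda>u. f u * g u) u = f u * partial i g u + partial i f u * g u"
  using partial_eq[OF has_derivative_mult[OF assms[THEN has_derivative_frechet]]]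
  by (simp add: partial_def)

lemma partial_chain:
  assumes "s differentiable (at u)" "(f has_real_derivative d) (at (s u))"
  shows "(\<lambda>u. f (s u)) differentiable (at u)" "partial i (\<lambda>u. f (s u)) u = d * partial i s u"
proof -
  from assms(2) have "(f has_derivative (\<lambda>h. d * h)) (at (s u))"
    by (simp add: has_field_derivative_def)
  then have *: "((\<lambda>u. f (s u)) has_derivative (\<lambda>h. d * frechet_derivative s (at u) h)) (at u)"
    using has_derivative_frechet[OF assms(1)] by (rule has_derivative_compose[rotated])
  show "(\<lambda>u. f (s u)) differentiable (at u)"
    using * by (auto simp: differentiable_def)
  show "partial i (\<lambda>u. f (s u)) u = d * partial i s u"
    using partial_eq[OF *] by (simp add: partial_def)
qed

lemma C_k_Suc_imp: "C_k (Suc k) f \<Longrightarrow> C_k k f"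
proof (induction k arbitrary: f)
  case 0
  then show ?case
    by (auto simp: continuous_on_eq_continuous_at intro: differentiable_imp_continuous_within)
next
  case (Suc k)
  then have "\<forall>u. f differentiable (at u)" "\<forall>i. C_k (Suc k) (partial i f)"
    by (auto simp only: C_k.simps(2))
  then show ?case using Suc.IH by (simp only: C_k.simps(2)) blast
qed

lemma C_k_mono: "C_k k f \<Longrightarrow> j \<le> k \<Longrightarrow> C_k j f"
  by (induction k) (auto simp: le_Suc_eq dest: C_k_Suc_imp simp del: C_k.simps(2))

lemma C_k_const [simp]: "C_k k (\<lambda>u. c)"
  by (induction k arbitrary: c) auto

lemma C_k_nth [simp]: "C_k k (\<lambda>u. u $ j)"
proof (cases k)
  case (Suc l)
  have "(\<lambda>u::real^2. u $ j) differentiable (at u)" for u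
    by (intro bounded_linear_imp_differentiable bounded_linear_vec_nth)
  then show ?thesis using Suc by simp
qed (simp add: continuous_on_component)

lemma C_k_add: "C_k k f \<Longrightarrow> C_k k g \<Longrightarrow> C_k k (\<lambda>u. f u + g u)"
proof (induction k arbitrary: f g)
  case (Suc k)
  then have "partial i (\<lambda>u. f u + g u) = (\<lambda>u. partial i f u + partial i g u)" for i
    by (auto simp: partial_add)
  then show ?case using Suc by simp
qed (simp add: continuous_on_add)

lemma C_k_mult: "C_k k f \<Longrightarrow> C_k k g \<Longrightarrow> C_k k (\<lambda>u. f u * g u)"
proof (induction k arbitrary: f g)
  case (Suc k)
  then have *: "partial i (\<lambda>u. f u * g u) = (\<lambda>u. f u * partial i g u + partial i f u * g u)" for i
    by (auto simp: partial_mult)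
  have "C_k k f" "C_k k g"
    using Suc.prems by (auto intro: C_k_Suc_imp simp del: C_k.simps)
  then show ?case using Suc by (auto simp: * intro: C_k_add)
qed (simp add: continuous_on_mult)

lemma C_k_minus: "C_k k f \<Longrightarrow> C_k k (\<lambda>u. - f u)"
  using C_k_mult[of k "\<lambda>u. -1" f] by simp

lemma C_k_diff: "C_k k f \<Longrightarrow> C_k k g \<Longrightarrow> C_k k (\<lambda>u. f u - g u)"
  using C_k_add[OF _ C_k_minus, of k f g] by simp

lemma C_k_power: "C_k k f \<Longrightarrow> C_k k (\<lambda>u. f u ^ n)"
  by (induction n) (auto intro: C_k_mult)

lemma C_k_sum: "(\<And>a. a \<in> S \<Longrightarrow> C_k k (f a)) \<Longrightarrow> C_k k (\<lambda>u. \<Sum>a\<in>S. f a u)"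
  by (induction S rule: infinite_finite_induct) (auto intro: C_k_add)

lemma C_k_poly: "C_k k f \<Longrightarrow> C_k k (\<lambda>u. poly p (f u))"
  by (induction p) (auto intro!: C_k_add C_k_mult)

lemma C_k_inverse: "C_k k f \<Longrightarrow> (\<And>u. f u \<noteq> 0) \<Longrightarrow> C_k k (\<lambda>u. inverse (f u))"
proof (induction k arbitrary: f)
  case (Suc k)
  have d: "f differentiable (at u)" for u using Suc.prems by simp
  have i: "(inverse has_real_derivative - (inverse (f u) ^ 2)) (at (f u))" for u
    using DERIV_inverse[OF Suc.prems(2)[of u]] by (simp add: power2_eq_square)
  note ch = partial_chain[OF d i]
  have "partial i (\<lambda>u. inverse (f u)) = (\<lambda>u. - (inverse (f u) ^ 2) * partial i f u)" for i
    by (auto simp: ch(2))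
  moreover have "C_k k (\<lambda>u. inverse (f u))"
    using Suc.IH[OF C_k_Suc_imp] Suc.prems by blast
  ultimately show ?case
    using Suc.prems ch(1) by (auto intro!: C_k_mult C_k_minus C_k_power)
qed (simp add: continuous_on_inverse)

text \<open>
  In HOL, \<open>ln (- x) = ln x\<close>, so these functions are two-sided continuous (differentiable) at \<open>0\<close>.
\<close>

lemma continuous_power_ln: "isCont (\<lambda>x::real. x ^ Suc k * ln x) x"
proof (cases "x = 0")
  case True
  have r: "((\<lambda>x::real. x * ln x) \<longlongrightarrow> 0) (at_right 0)" by real_asymp
  have "((\<lambda>x::real. - (x * ln x)) \<longlongrightarrow> 0) (at_right 0)"
    using tendsto_minus[OF r] by simp
  then have l: "((\<lambda>x::real. x * ln x) \<longlongrightarrow> 0) (at_left 0)"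
    by (subst filterlim_at_left_to_right) (simp add: ln_minus)
  have "((\<lambda>x::real. x * ln x) \<longlongrightarrow> 0) (at 0)"
    using l r filterlim_split_at by blast
  then have "((\<lambda>x::real. x ^ k * (x * ln x)) \<longlongrightarrow> 0 ^ k * 0) (at 0)"
    by (intro tendsto_intros)
  then have "((\<lambda>x::real. x ^ Suc k * ln x) \<longlongrightarrow> 0) (at 0)"
    by (simp add: mult_ac)
  then show ?thesis using True by (simp add: isCont_def)
next
  case False
  then show ?thesis by (intro continuous_intros)
qed

lemma has_derivative_power_ln:
  "((\<lambda>x::real. x ^ Suc (Suc k) * ln x) has_real_derivative
     (real (Suc (Suc k)) * (x ^ Suc k * ln x) + x ^ Suc k)) (at x)"
proof (cases "x = 0")
  case True
  \<comment> \<open>At \<open>0\<close> the difference quotient is \<open>x ^ Suc k * ln x\<close>,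
    to which the preceding continuity applies.\<close>
  have "((\<lambda>x::real. x ^ Suc k * ln x) \<longlongrightarrow> 0) (at 0)"
    using continuous_power_ln[where k = k and x = 0] by (simp add: isCont_def)
  moreover have "\<forall>\<^sub>F x::real in at 0. x ^ Suc k * ln x = x ^ Suc (Suc k) * ln x / x"
    by (auto simp: eventually_at_filter)
  ultimately have "((\<lambda>x::real. x ^ Suc (Suc k) * ln x / x) \<longlongrightarrow> 0) (at 0)"
    by (rule Lim_transform_eventually)
  then show ?thesis using True by (simp add: DERIV_def)
next
  case False
  have "(ln has_real_derivative inverse x) (at x)"
  proof (cases "x > 0")
    case True then show ?thesis by (simp add: DERIV_ln)
  next
    case neg: False
    have "((\<lambda>x::real. ln (- x)) has_real_derivative inverse x) (at x)"
      using neg False by (auto intro!: derivative_eq_intros simp: field_simps)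
    then show ?thesis by (simp add: ln_minus)
  qed
  from DERIV_mult[OF DERIV_pow[of "Suc (Suc k)"] this] show ?thesis
    using False by (simp add: field_simps)
qed

text \<open>Each differentiation lowers the power in front of the logarithm by one and otherwise
  adds only powers of \<open>s\<close>. So the power \<open>k + 1\<close> allows \<open>k\<close>
  derivatives, the last one still continuous where \<open>s\<close> vanishes.\<close>

lemma C_k_power_ln:
  "C_k k s \<Longrightarrow> C_k k (\<lambda>u. s u ^ Suc k * ln (s u))"
proof (induction k)
  case 0
  have "continuous_on UNIV (\<lambda>x::real. x ^ Suc 0 * ln x)"
    by (intro continuous_at_imp_continuous_on ballI continuous_power_ln)
  from continuous_on_compose2[OF this] 0 show ?case by simp
next
  case (Suc k)
  have d: "s differentiable (at u)" for u using Suc.prems by simp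
  note ch = partial_chain[OF d has_derivative_power_ln]
  have "partial i (\<lambda>u. s u ^ Suc (Suc k) * ln (s u)) =
     (\<lambda>u. (real (Suc (Suc k)) * (s u ^ Suc k * ln (s u)) + s u ^ Suc k) * partial i s u)" for i
    by (rule ext) (rule ch(2))
  moreover have "C_k k s" using Suc.prems by (rule C_k_Suc_imp)
  ultimately show ?case
    using Suc.prems Suc.IH ch(1)
    by (auto intro!: C_k_mult C_k_add C_k_power simp del: power_Suc)
qed

section \<open>Stereographic charts\<close>

lemma norm2_vec2: "(norm (u :: real ^ 2))\<^sup>2 = (u $ 1)\<^sup>2 + (u $ 2)\<^sup>2"
  unfolding power2_norm_eq_inner by (simp add: inner_vec_def sum_2 power2_eq_square)

lemma C_k_stereo: "C_k k (\<lambda>u. stereo s u $ i)"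
proof -
  have q: "C_k k (\<lambda>u::real^2. inverse ((norm u)\<^sup>2 + 1))"
    unfolding norm2_vec2
    by (intro C_k_inverse C_k_add C_k_power C_k_nth C_k_const)
       (smt (verit) zero_le_power2)
  have *: "C_k k (\<lambda>u. stereo s u $ 1)" "C_k k (\<lambda>u. stereo s u $ 2)" "C_k k (\<lambda>u. stereo s u $ 3)"
    unfolding stereo_def vector_scaleR_component vector_3 real_scaleR_def divide_inverse mult_1
    by (intro C_k_mult[OF q] C_k_diff C_k_mult C_k_nth C_k_const;
        simp add: norm2_vec2 C_k_add C_k_power)+
  then show ?thesis using exhaust_3[of i] by auto
qed

lemma stereo_nth:
  "stereo s u $ 1 = 2 * u $ 1 / ((norm u)\<^sup>2 + 1)"
  "stereo s u $ 2 = 2 * u $ 2 / ((norm u)\<^sup>2 + 1)"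
  "stereo s u $ 3 = s * ((norm u)\<^sup>2 - 1) / ((norm u)\<^sup>2 + 1)"
  by (simp_all add: stereo_def)

lemma stereo_in_S2:
  assumes "s \<in> {1, -1}"
  shows "stereo s u \<in> S2"
proof -
  define a b r where "a = u $ 1" "b = u $ 2" "r = (norm u)\<^sup>2"
  have r: "r = a\<^sup>2 + b\<^sup>2" "r + 1 > 0"
    by (auto simp: a_b_r_def norm2_vec2 add_nonneg_pos)
  have eq: "(2 * a)\<^sup>2 + (2 * b)\<^sup>2 + (s * (r - 1))\<^sup>2 = (r + 1)\<^sup>2"
    using assms by (auto simp: r power2_eq_square algebra_simps)
  have "(norm (stereo s u))\<^sup>2 = (2 * a / (r + 1))\<^sup>2 + (2 * b / (r + 1))\<^sup>2 + (s * (r - 1) / (r + 1))\<^sup>2"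
    unfolding power2_norm_eq_inner
    by (simp add: inner_vec_def sum_3 stereo_nth a_b_r_def power2_eq_square)
  also have "\<dots> = ((2 * a)\<^sup>2 + (2 * b)\<^sup>2 + (s * (r - 1))\<^sup>2) / (r + 1)\<^sup>2"
    by (simp add: power_divide add_divide_distrib)
  also have "\<dots> = 1" unfolding eq using r(2) by simp
  finally show ?thesis by (simp add: power2_eq_1_iff) (smt (verit) norm_ge_zero)
qed

lemma stereo_surj:
  assumes "y \<in> S2"
  obtains s u where "s \<in> {1, -1}" "y = stereo s u"
proof -
  have n: "(y $ 1)\<^sup>2 + (y $ 2)\<^sup>2 + (y $ 3)\<^sup>2 = 1"
    using assms power2_norm_eq_inner[of y] by (simp add: inner_vec_def sum_3 power2_eq_square)
  \<comment> \<open>The chart projects from a pole other than \<open>y\<close>: the south pole if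
    \<open>y\<close> is the north pole, the north pole otherwise. This ensures
    \<open>t \<noteq> 1\<close>, and \<open>u\<close> is the usual stereographic projection of
    \<open>y\<close>.\<close>
  define s :: real where "s = (if y $ 3 = 1 then -1 else 1)"
  define t where "t = s * y $ 3"
  define u :: "real ^ 2" where "u = (1 / (1 - t)) *\<^sub>R vector [y $ 1, y $ 2]"
  have t: "t \<noteq> 1" by (auto simp: t_def s_def)
  have s2: "s * s = 1" "s \<in> {1, -1}" by (auto simp: s_def)
  have n': "(y $ 1)\<^sup>2 + (y $ 2)\<^sup>2 = (1 - t) * (1 + t)"
    using n s2 by (auto simp: t_def power2_eq_square algebra_simps)
  have "(norm u)\<^sup>2 = (1 / (1 - t))\<^sup>2 * ((y $ 1)\<^sup>2 + (y $ 2)\<^sup>2)"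
    unfolding norm2_vec2 by (simp add: u_def power2_eq_square algebra_simps)
  also have "\<dots> = (1 + t) / (1 - t)"
    unfolding n' using t by (simp add: power2_eq_square)
  finally have N: "(norm u)\<^sup>2 = (1 + t) / (1 - t)" .
  have N1: "(norm u)\<^sup>2 + 1 = 2 / (1 - t)" "(norm u)\<^sup>2 - 1 = 2 * t / (1 - t)"
    unfolding N using t by (auto simp: field_simps)
  have "stereo s u $ 1 = y $ 1" "stereo s u $ 2 = y $ 2"
    unfolding stereo_def N1 using t by (auto simp: u_def field_simps)
  moreover have "stereo s u $ 3 = y $ 3"
    unfolding stereo_def N1 using t s2 by (auto simp: t_def field_simps)
  ultimately have "y = stereo s u"
    by (subst Finite_Cartesian_Product.vec_eq_iff) (simp add: forall_3)
  with s2 that show ?thesis by blast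
qed

lemma C_k_sph_harm: "C_k k (\<lambda>u. sph_harm l \<mu> (stereo s u))"
proof -
  \<comment> \<open>Real and imaginary parts share one induction, since each part of the next power
    involves both parts of the previous one.\<close>
  have w: "C_k k (\<lambda>u. Re (Complex (stereo s u $ 1) (stereo s u $ 2) ^ n)) \<and>
        C_k k (\<lambda>u. Im (Complex (stereo s u $ 1) (stereo s u $ 2) ^ n))" for n
    by (induction n) (auto intro!: C_k_diff C_k_add C_k_mult C_k_stereo)
  show ?thesis
    unfolding sph_harm_def Let_def
    using w by (cases "\<mu> \<ge> 0") (auto intro!: C_k_mult C_k_poly C_k_stereo)
qed

lemma C_k_tps: "k < m - 1 \<Longrightarrow> C_k k (\<lambda>u. tps m (stereo s u) z)"
proof -
  assume k: "k < m - 1"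
  then obtain n where n: "m - 1 = Suc n" "k \<le> n" by (cases "m - 1") auto
  have "C_k n (\<lambda>u. 1 - stereo s u \<bullet> z)"
    unfolding inner_vec_def inner_real_def by (intro C_k_diff C_k_sum C_k_mult C_k_stereo C_k_const)
  from C_k_power_ln[OF this] have "C_k n (\<lambda>u. tps m (stereo s u) z)"
    unfolding tps_def tps_phi_def n .
  then show ?thesis using n C_k_mono by blast
qed

text \<open>A differential operator has prescribed values on \<open>C_k_sphere k\<close> only, so
  its action on splines depends on this. The bound on \<open>k\<close> comes from the kernel, whose
  power \<open>m - 1\<close> leaves \<open>m - 2\<close> derivatives; the harmonics are
  smooth.\<close>

lemma spline_in_C_k_sphere: "k < m - 1 \<Longrightarrow> spline m Z a b \<in> C_k_sphere k"
  unfolding C_k_sphere_def spline_def sph_sum_def comp_def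
  by (auto intro!: C_k_add C_k_sum C_k_mult C_k_tps C_k_sph_harm)

section \<open>Linearity of differential operators\<close>

lemma C_k_partial_funpow: "C_k (k + j) f \<Longrightarrow> C_k k ((partial i ^^ j) f)"
proof (induction j arbitrary: k)
  case (Suc j)
  have "C_k (Suc k) ((partial i ^^ j) f)"
    using Suc.IH[of "Suc k"] Suc.prems by (simp only: add_Suc add_Suc_right)
  then show ?case by simp
qed simp

lemma partial_funpow_linear:
  assumes "C_k j f" "C_k j g"
  shows "(partial i ^^ j) (\<lambda>u. c * f u + g u) =
    (\<lambda>u. c * (partial i ^^ j) f u + (partial i ^^ j) g u)"
  using assms
proof (induction j)
  case (Suc j)
  have d: "(partial i ^^ j) f differentiable (at u)" "(partial i ^^ j) g differentiable (at u)" for u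
    using C_k_partial_funpow[of 1 j f i] C_k_partial_funpow[of 1 j g i] Suc.prems by auto
  have IH: "(partial i ^^ j) (\<lambda>u. c * f u + g u) =
    (\<lambda>u. c * (partial i ^^ j) f u + (partial i ^^ j) g u)"
    using Suc by (auto intro: C_k_Suc_imp simp del: C_k.simps)
  show ?case
    using d by (auto simp: IH partial_add partial_mult)
qed simp

text \<open>The charts see a function only through its values on the sphere. Agreement of
  \<open>h\<close> with \<open>c * f + g\<close> is therefore asked for there alone, which suits the
  Lagrange expansion, an identity on the sphere.\<close>

lemma differential_operator_linear:
  assumes L: "differential_operator k L" and f: "f \<in> C_k_sphere k" and g: "g \<in> C_k_sphere k"
    and h: "h \<in> C_k_sphere k"
    and eq: "\<And>y. y \<in> S2 \<Longrightarrow> h y = c * f y + g y" and x: "x \<in> S2"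
  shows "L h x = c * L f x + L g x"
proof -
  obtain s u where s: "s \<in> {1, -1}" and x: "x = stereo s u" using x stereo_surj by metis
  obtain d where d: "\<And>g u. g\<in>C_k_sphere k \<Longrightarrow>
           L g (stereo s u) =
             (\<Sum>i\<le>k. \<Sum>j\<le>k - i.
                d i j u * (partial 1 ^^ i) ((partial 2 ^^ j) (g \<circ> stereo s)) u)"
  proof -
    from bspec[OF L[unfolded differential_operator_def] s]
    obtain d where "\<forall>g\<in>C_k_sphere k. \<forall>u.
           L g (stereo s u) =
             (\<Sum>i\<le>k. \<Sum>j\<le>k - i.
                d i j u * (partial 1 ^^ i) ((partial 2 ^^ j) (g \<circ> stereo s)) u)"
      by (elim exE conjE)
    then show ?thesis by (intro that) (drule (1) bspec, erule spec)
  qed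
  have hs: "h \<circ> stereo s = (\<lambda>u. c * (f \<circ> stereo s) u + (g \<circ> stereo s) u)"
    using eq stereo_in_S2[OF s] by auto
  have Ck: "C_k k (f \<circ> stereo s)" "C_k k (g \<circ> stereo s)"
    using f g s by (auto simp: C_k_sphere_def)
  have "(partial 1 ^^ i) ((partial 2 ^^ j) (h \<circ> stereo s)) u =
     c * (partial 1 ^^ i) ((partial 2 ^^ j) (f \<circ> stereo s)) u +
     (partial 1 ^^ i) ((partial 2 ^^ j) (g \<circ> stereo s)) u" if "i \<le> k" "j \<le> k - i" for i j
  proof -
    have ij: "C_k (i + j) (f \<circ> stereo s)" "C_k (i + j) (g \<circ> stereo s)"
      using C_k_mono[OF Ck(1)] C_k_mono[OF Ck(2)] that by auto
    have "(partial 2 ^^ j) (h \<circ> stereo s) =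
       (\<lambda>u. c * (partial 2 ^^ j) (f \<circ> stereo s) u + (partial 2 ^^ j) (g \<circ> stereo s) u)"
      unfolding hs by (intro partial_funpow_linear C_k_mono[OF ij(1)] C_k_mono[OF ij(2)]) auto
    then show ?thesis
      using partial_funpow_linear[OF C_k_partial_funpow[OF ij(1)] C_k_partial_funpow[OF ij(2)]]
      by simp
  qed
  then show ?thesis
    unfolding x by (simp add: d f g h sum_distrib_left sum.distrib algebra_simps)
qed

section \<open>Matrices close to the identity\<close>

text \<open>Zero is included because entries of vectors may vanish. With one endpoint
  \<open>0\<close>, convexity reads \<open>(c * z) powr r \<le> c * z powr r\<close>, true since
  \<open>c powr r \<le> c\<close> for \<open>0 < c < 1\<close>.\<close>

lemma powr_convex_atLeast:
  assumes "1 \<le> r"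
  shows "convex_on {0..} (\<lambda>x::real. x powr r)"
proof (rule convex_onI)
  fix t x y :: real
  assume t: "0 < t" "t < 1" and xy: "x \<in> {0..}" "y \<in> {0..}"
  have scale: "(c * z) powr r \<le> c * z powr r" if "0 < c" "c < 1" "z \<ge> 0" for c z :: real
  proof -
    have "c powr r \<le> c powr 1" using that assms by (intro powr_mono') auto
    then show ?thesis using that by (simp add: powr_mult mult_right_mono)
  qed
  consider "x = 0" | "y = 0" | "x > 0" "y > 0" using xy by fastforce
  then show "((1 - t) *\<^sub>R x + t *\<^sub>R y) powr r \<le> (1 - t) * x powr r + t * y powr r"
  proof cases
    case 3
    then show ?thesis using convex_onD[OF powr_convex[OF assms], of t x y] t by simp
  qed (use t xy scale in auto)
qed auto

lemma lp_norm_real: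
  assumes "1 \<le> p" "p \<noteq> \<infinity>"
  obtains r where "1 \<le> r" "real_of_ereal p = r"
    "\<And>v. lp_norm p v = (\<Sum>i<dim_vec v. \<bar>vec_index v i\<bar> powr r) powr (1 / r)"
proof -
  have "1 \<le> real_of_ereal p" using assms by (cases p) (auto simp: one_ereal_def)
  then show ?thesis using that assms by (simp add: lp_norm_def)
qed

lemma abs_le_lp_norm_infty:
  "i < dim_vec v \<Longrightarrow> \<bar>vec_index v i\<bar> \<le> lp_norm \<infinity> v"
  by (auto simp: lp_norm_def intro!: Max_ge)

lemma lp_norm_infty_le:
  assumes "0 \<le> R" "\<And>i. i < dim_vec v \<Longrightarrow> \<bar>vec_index v i\<bar> \<le> R"
  shows "lp_norm \<infinity> v \<le> R"
  using assms by (auto simp: lp_norm_def)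

lemma lp_norm_infty_nonneg: "0 \<le> lp_norm \<infinity> v"
  by (auto simp: lp_norm_def intro!: Max_ge)

text \<open>
  Jensen's inequality is applied to the midpoint of \<open>\<bar>g k\<bar>\<close> and the mean of \<open>\<bar>g\<bar>\<close>; the factor \<open>2\<close>
  of the theorem comes from here.
\<close>

lemma lp_norm_le_twice:
  assumes p: "1 \<le> p" and dim: "dim_vec w = n" "dim_vec g = n"
    and le: "\<And>k. k < n \<Longrightarrow> \<bar>vec_index w k\<bar> \<le> \<bar>vec_index g k\<bar> + (\<Sum>j<n. \<bar>vec_index g j\<bar>) / n"
  shows "lp_norm p w \<le> 2 * lp_norm p g"
proof (cases "p = \<infinity>")
  case True
  have "(\<Sum>j<n. \<bar>vec_index g j\<bar>) / n \<le> lp_norm \<infinity> g" if "n > 0"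
  proof -
    have "(\<Sum>j<n. \<bar>vec_index g j\<bar>) \<le> real (card {..<n}) * lp_norm \<infinity> g"
      using dim by (intro sum_bounded_above) (auto intro: abs_le_lp_norm_infty)
    then show ?thesis using that by (simp add: field_simps)
  qed
  then have "\<bar>vec_index w k\<bar> \<le> 2 * lp_norm \<infinity> g" if "k < n" for k
    using le[OF that] abs_le_lp_norm_infty[of k g] that dim by fastforce
  then show ?thesis
    using True dim lp_norm_infty_nonneg[of g] by (auto intro!: lp_norm_infty_le)
next
  case False
  with p obtain r where r: "1 \<le> r"
    and norm: "\<And>v. lp_norm p v = (\<Sum>i<dim_vec v. \<bar>vec_index v i\<bar> powr r) powr (1 / r)"
    by (metis lp_norm_real)
  note conv = powr_convex_atLeast[OF r]
  define S where "S = (\<Sum>j<n. \<bar>vec_index g j\<bar> powr r)"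
  define a where "a = (\<Sum>j<n. \<bar>vec_index g j\<bar>) / n"
  have a0: "a \<ge> 0" by (auto simp: a_def intro!: divide_nonneg_nonneg sum_nonneg)
  have S0: "S \<ge> 0" by (auto simp: S_def intro!: sum_nonneg)
  have w: "\<bar>vec_index w k\<bar> powr r \<le> 2 powr r * (\<bar>vec_index g k\<bar> powr r / 2 + S / n / 2)" if "k < n" for k
  proof -
    have "a powr r \<le> S / n"
      using convex_on_sum[OF _ _ conv, of "{..<n}" "\<lambda>_. 1 / n" "\<lambda>j. \<bar>vec_index g j\<bar>"] that
      by (auto simp: a_def S_def sum_divide_distrib)
    moreover have "(\<bar>vec_index g k\<bar> / 2 + a / 2) powr r \<le> \<bar>vec_index g k\<bar> powr r / 2 + a powr r / 2"
      using convex_onD[OF conv, of "1/2" "\<bar>vec_index g k\<bar>" a] a0 by simp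
    moreover have "\<bar>vec_index w k\<bar> powr r \<le> (2 * (\<bar>vec_index g k\<bar> / 2 + a / 2)) powr r"
      using le[OF that] r by (intro powr_mono2) (auto simp: a_def)
    moreover have "\<dots> = 2 powr r * (\<bar>vec_index g k\<bar> / 2 + a / 2) powr r"
      using a0 by (intro powr_mult)
    ultimately have "(\<bar>vec_index g k\<bar> / 2 + a / 2) powr r \<le> \<bar>vec_index g k\<bar> powr r / 2 + S / n / 2"
      "\<bar>vec_index w k\<bar> powr r \<le> 2 powr r * (\<bar>vec_index g k\<bar> / 2 + a / 2) powr r" by auto
    then show ?thesis by (meson mult_left_mono order_trans powr_ge_zero)
  qed
  have "(\<Sum>k<n. \<bar>vec_index w k\<bar> powr r) \<le> (\<Sum>k<n. 2 powr r * (\<bar>vec_index g k\<bar> powr r / 2 + S / n / 2))"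
    by (intro sum_mono w) auto
  \<comment> \<open>Both halves contribute \<open>S / 2\<close>, as \<open>S / n / 2\<close> is
    added \<open>n\<close> times; \<open>n = 0\<close> is separate because of the quotient.\<close>
  also have "\<dots> = 2 powr r * S"
  proof (cases "n = 0")
    case False
    then show ?thesis
      unfolding sum_distrib_left[symmetric] sum.distrib sum_divide_distrib[symmetric]
      by (simp flip: S_def)
  qed (simp add: S_def)
  finally have "lp_norm p w \<le> (2 powr r * S) powr (1 / r)"
    unfolding norm dim using r by (intro powr_mono2) (auto intro!: sum_nonneg)
  also have "\<dots> = 2 * S powr (1 / r)"
    using r S0 by (simp add: powr_mult powr_powr)
  finally show ?thesis by (simp add: norm dim S_def)
qed

lemma abs_le_1_if_lp_norm_le_1:
  assumes p: "1 \<le> p" and v: "lp_norm p v \<le> 1" and i: "i < dim_vec v"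
  shows "\<bar>vec_index v i\<bar> \<le> 1"
proof (cases "p = \<infinity>")
  case True
  then show ?thesis using abs_le_lp_norm_infty[OF i] v by simp
next
  case False
  with p obtain r where r: "1 \<le> r"
    and norm: "\<And>v. lp_norm p v = (\<Sum>i<dim_vec v. \<bar>vec_index v i\<bar> powr r) powr (1 / r)"
    by (metis lp_norm_real)
  define S where "S = (\<Sum>i<dim_vec v. \<bar>vec_index v i\<bar> powr r)"
  have le: "\<bar>vec_index v i\<bar> powr r \<le> S"
    unfolding S_def using i by (intro member_le_sum) auto
  have "S \<le> 1"
    using v gr_one_powr[of S "1/r"] r by (fastforce simp: norm simp flip: S_def)
  with le have "\<bar>vec_index v i\<bar> powr r \<le> 1" by simp
  then show ?thesis
    using gr_one_powr[of "\<bar>vec_index v i\<bar>" r] r by fastforce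
qed

lemma lp_norm_le_const:
  assumes p: "1 \<le> p"
  shows "\<exists>C. \<forall>v \<in> carrier_vec n. (\<forall>i<n. \<bar>vec_index v i\<bar> \<le> R) \<longrightarrow> lp_norm p v \<le> C"
proof (cases "p = \<infinity>")
  case True
  then show ?thesis
    by (intro exI[of _ "max 0 R"] ballI impI) (auto intro!: lp_norm_infty_le)
next
  case False
  with p obtain r where r: "1 \<le> r"
    and norm: "\<And>v. lp_norm p v = (\<Sum>i<dim_vec v. \<bar>vec_index v i\<bar> powr r) powr (1 / r)"
    by (metis lp_norm_real)
  show ?thesis
  proof (intro exI[of _ "(\<Sum>i<n. R powr r) powr (1 / r)"] ballI impI)
    fix v :: "real Matrix.vec" assume v: "v \<in> carrier_vec n" "\<forall>i<n. \<bar>vec_index v i\<bar> \<le> R"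
    then have "(\<Sum>i<n. \<bar>vec_index v i\<bar> powr r) \<le> (\<Sum>i<n. R powr r)"
      using r by (intro sum_mono powr_mono2) auto
    then show "lp_norm p v \<le> (\<Sum>i<n. R powr r) powr (1 / r)"
      unfolding norm using v r by (intro powr_mono2) (auto intro!: sum_nonneg)
  qed
qed

text \<open>The operator norm is a supremum of reals and bounds its members only if the set is
  bounded. Vectors of the unit ball have entries of modulus at most 1, so those of
  \<open>M *\<^sub>v v\<close> are at most the sum of all
  \<open>\<bar>M $$ (i, j)\<bar>\<close>.\<close>

lemma bdd_above_lp_norm_image:
  assumes p: "1 \<le> p" and M: "M \<in> carrier_mat n n"
  shows "bdd_above ((\<lambda>v. lp_norm p (M *\<^sub>v v)) ` {v \<in> carrier_vec n. lp_norm p v \<le> 1})"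
proof -
  define R where "R = (\<Sum>i<n. \<Sum>j<n. \<bar>M $$ (i, j)\<bar>)"
  obtain C where C: "\<And>v. v \<in> carrier_vec n \<Longrightarrow> (\<And>i. i < n \<Longrightarrow> \<bar>vec_index v i\<bar> \<le> R) \<Longrightarrow> lp_norm p v \<le> C"
    using lp_norm_le_const[OF p] by metis
  show ?thesis
  proof (rule bdd_aboveI2[of _ _ C], rule C)
    fix v i assume v: "v \<in> {v \<in> carrier_vec n. lp_norm p v \<le> 1}" and i: "i < n"
    have "vec_index (M *\<^sub>v v) i = (\<Sum>j<n. M $$ (i, j) * vec_index v j)"
      using M v i by (auto simp: scalar_prod_def lessThan_atLeast0)
    also have "\<bar>\<dots>\<bar> \<le> (\<Sum>j<n. \<bar>M $$ (i, j)\<bar>)"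
    proof (rule order_trans[OF sum_abs sum_mono])
      fix j assume "j \<in> {..<n}"
      then have "\<bar>vec_index v j\<bar> \<le> 1" using abs_le_1_if_lp_norm_le_1[OF p] v by auto
      then show "\<bar>M $$ (i, j) * vec_index v j\<bar> \<le> \<bar>M $$ (i, j)\<bar>"
        by (simp add: abs_mult mult_left_le)
    qed
    also have "\<dots> \<le> R"
      unfolding R_def using i
      by (intro member_le_sum[where f = "\<lambda>i. \<Sum>j<n. \<bar>M $$ (i, j)\<bar>"]) (auto intro!: sum_nonneg)
    finally show "\<bar>vec_index (M *\<^sub>v v) i\<bar> \<le> R" .
  qed (use M in auto)
qed

lemma lp_norm_zero: "1 \<le> p \<Longrightarrow> lp_norm p (0\<^sub>v n) = 0"
proof (cases "p = \<infinity>")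
  case True
  then show ?thesis
    using lp_norm_infty_le[of 0 "0\<^sub>v n"] lp_norm_infty_nonneg[of "0\<^sub>v n"] by simp
next
  assume "1 \<le> p"
  case False
  with \<open>1 \<le> p\<close> obtain r where r: "1 \<le> r"
    and norm: "\<And>v. lp_norm p v = (\<Sum>i<dim_vec v. \<bar>vec_index v i\<bar> powr r) powr (1 / r)"
    by (metis lp_norm_real)
  show ?thesis unfolding norm by simp
qed

text \<open>The perturbation moves each entry by at most \<open>S / (2 * n)\<close>, where
  \<open>S\<close> is the sum of all moduli of entries of \<open>w\<close>. Summing over the rows
  bounds \<open>S / 2\<close> by the corresponding sum for \<open>B w\<close>, and inserting this
  back eliminates \<open>S\<close>. In particular \<open>B w = 0\<close> forces
  \<open>w = 0\<close>.\<close>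

lemma mult_mat_vec_lower_bound:
  fixes B :: "real mat"
  assumes B: "B \<in> carrier_mat n n" and w: "w \<in> carrier_vec n"
    and near: "\<And>i j. i < n \<Longrightarrow> j < n \<Longrightarrow> \<bar>B $$ (i, j) - (if i = j then 1 else 0)\<bar> \<le> 1 / (2 * real n)"
    and k: "k < n"
  shows "\<bar>vec_index w k\<bar> \<le> \<bar>vec_index (B *\<^sub>v w) k\<bar> + (\<Sum>j<n. \<bar>vec_index (B *\<^sub>v w) j\<bar>) / n"
proof -
  define S where "S = (\<Sum>j<n. \<bar>vec_index w j\<bar>)"
  have le: "\<bar>vec_index w i\<bar> \<le> \<bar>vec_index (B *\<^sub>v w) i\<bar> + S / (2 * real n)" if i: "i < n" for i
  proof -
    let ?E = "\<lambda>j. B $$ (i, j) - (if i = j then 1 else 0)"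
    have "vec_index (B *\<^sub>v w) i = (\<Sum>j<n. B $$ (i, j) * vec_index w j)"
      using B w i by (auto simp: scalar_prod_def lessThan_atLeast0)
    also have "\<dots> = (\<Sum>j<n. ?E j * vec_index w j + (if i = j then vec_index w j else 0))"
      by (intro sum.cong) (auto simp: algebra_simps)
    also have "\<dots> = (\<Sum>j<n. ?E j * vec_index w j) + vec_index w i"
      using i by (simp add: sum.distrib)
    finally have eq: "vec_index (B *\<^sub>v w) i = (\<Sum>j<n. ?E j * vec_index w j) + vec_index w i" .
    have "\<bar>\<Sum>j<n. ?E j * vec_index w j\<bar> \<le> (\<Sum>j<n. 1 / (2 * real n) * \<bar>vec_index w j\<bar>)"
      unfolding abs_mult using near[OF i]
      by (intro order_trans[OF sum_abs sum_mono]) (simp only: abs_mult lessThan_iff mult_right_mono abs_ge_zero)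
    also have "\<dots> = S / (2 * real n)" by (simp add: S_def sum_divide_distrib)
    finally show ?thesis using eq by linarith
  qed
  have "S \<le> (\<Sum>i<n. \<bar>vec_index (B *\<^sub>v w) i\<bar> + S / (2 * real n))"
    using le unfolding S_def[symmetric] by (subst S_def) (auto intro!: sum_mono)
  also have "\<dots> = (\<Sum>i<n. \<bar>vec_index (B *\<^sub>v w) i\<bar>) + S / 2"
    using k by (simp add: sum.distrib)
  finally have "S / 2 \<le> (\<Sum>i<n. \<bar>vec_index (B *\<^sub>v w) i\<bar>)" by simp
  from divide_right_mono[OF this, of "real n"] le[OF k] show ?thesis by simp
qed

text \<open>A right inverse of a square matrix is also a left inverse, so \<open>mat_inverse\<close>
  cannot return \<open>None\<close> and its value is determined.\<close>

lemma inverse_mat_eqI: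
  fixes A :: "real mat"
  assumes A: "A \<in> carrier_mat n n" and B: "B \<in> carrier_mat n n" and AB: "A * B = 1\<^sub>m n"
  shows "inverse_mat A = B" "invertible_mat A"
proof -
  have BA: "B * A = 1\<^sub>m n" using mat_mult_left_right_inverse[OF A B AB] .
  show "invertible_mat A"
    using A B AB BA by (auto simp: invertible_mat_def inverts_mat_def)
  have "A \<in> Units (ring_mat TYPE(real) n n)"
    using A B AB BA by (auto simp: Units_def ring_mat_simps)
  with mat_inverse(1)[OF A] obtain C where C: "mat_inverse A = Some C" by fastforce
  from mat_inverse(2)[OF A C] have C': "C * A = 1\<^sub>m n" "C \<in> carrier_mat n n" by auto
  have "C = C * (A * B)" using AB C' by simp
  also have "\<dots> = (C * A) * B" using assoc_mult_mat[OF C'(2) A B] by simp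
  also have "\<dots> = B" using C' B by simp
  finally show "inverse_mat A = B" by (simp add: inverse_mat_def C)
qed

lemma invertible_matE:
  fixes A :: "real mat"
  assumes A: "A \<in> carrier_mat n n" and inv: "invertible_mat A"
  obtains B where "B \<in> carrier_mat n n" "A * B = 1\<^sub>m n" "B * A = 1\<^sub>m n"
proof -
  obtain B where B: "A * B = 1\<^sub>m n" "B * A = 1\<^sub>m (dim_row B)"
    using A inv by (auto simp: invertible_mat_def inverts_mat_def)
  \<comment> \<open>\<open>invertible_mat\<close> leaves the dimensions of the inverse open; they
    are read off from the two products.\<close>
  have "dim_col B = n" using arg_cong[OF B(1), of dim_col] by simp
  moreover have "dim_row B = n" using arg_cong[OF B(2), of dim_col] A by simp
  ultimately show ?thesis using that B by auto
qed

text \<open>The inverse of \<open>M * B\<close> is \<open>Bi * Mi\<close>. For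
  \<open>w = Bi (Mi v)\<close> the product \<open>B w\<close> is \<open>Mi v\<close>, so the lower
  bound for \<open>B\<close> compares \<open>w\<close> with \<open>Mi v\<close> one vector at a
  time, before any supremum is taken.\<close>

lemma lp_opnorm_inverse_mult_le:
  fixes M B :: "real mat"
  assumes p: "1 \<le> p" and M: "M \<in> carrier_mat n n" and B: "B \<in> carrier_mat n n"
    and near: "\<And>i j. i < n \<Longrightarrow> j < n \<Longrightarrow> \<bar>B $$ (i, j) - (if i = j then 1 else 0)\<bar> \<le> 1 / (2 * real n)"
    and inv: "invertible_mat M"
  shows "invertible_mat (M * B)" "lp_opnorm p (inverse_mat (M * B)) \<le> 2 * lp_opnorm p (inverse_mat M)"
proof -
  note lower = mult_mat_vec_lower_bound[OF B _ near]
  have "Determinant.det B \<noteq> 0"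
  proof
    assume "Determinant.det B = 0"
    then obtain v where v: "v \<in> carrier_vec n" "v \<noteq> 0\<^sub>v n" "B *\<^sub>v v = 0\<^sub>v n"
      using det_0_iff_vec_prod_zero[OF B] by blast
    have "vec_index v i = 0" if "i < n" for i
      using lower[OF v(1) _ _ that] v(3) that by simp
    then have "v = 0\<^sub>v n" using v(1) by (intro eq_vecI) auto
    with v show False by simp
  qed
  then obtain Bi where Bi: "Bi \<in> carrier_mat n n" "B * Bi = 1\<^sub>m n"
    using det_non_zero_imp_unit[OF B, of "()"] by (auto simp: Units_def ring_mat_simps)
  obtain Mi where Mi: "Mi \<in> carrier_mat n n" "M * Mi = 1\<^sub>m n"
    using invertible_matE[OF M inv] by metis
  have "(M * B) * (Bi * Mi) = M * ((B * Bi) * Mi)"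
    using M B Bi(1) Mi(1) by (simp add: assoc_mult_mat[of _ n n _ n _ n])
  also have "\<dots> = 1\<^sub>m n" using Bi Mi by simp
  finally have MB: "(M * B) * (Bi * Mi) = 1\<^sub>m n" .
  have c: "M * B \<in> carrier_mat n n" "Bi * Mi \<in> carrier_mat n n" using M B Bi Mi by auto
  note eq = inverse_mat_eqI[OF c MB] inverse_mat_eqI(1)[OF M Mi]
  show "invertible_mat (M * B)" by (rule eq)
  have "lp_norm p ((Bi * Mi) *\<^sub>v v) \<le> 2 * lp_opnorm p Mi"
    if v: "v \<in> carrier_vec n" "lp_norm p v \<le> 1" for v
  proof -
    have carr: "Mi *\<^sub>v v \<in> carrier_vec n" "(Bi * Mi) *\<^sub>v v \<in> carrier_vec n"
      using Mi Bi v by auto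
    have "B *\<^sub>v ((Bi * Mi) *\<^sub>v v) = (B * (Bi * Mi)) *\<^sub>v v"
      using B c v by (simp add: assoc_mult_mat_vec)
    also have "B * (Bi * Mi) = (B * Bi) * Mi"
      using assoc_mult_mat[OF B Bi(1) Mi(1)] by simp
    finally have "B *\<^sub>v ((Bi * Mi) *\<^sub>v v) = Mi *\<^sub>v v" using Bi Mi by simp
    with lower[OF carr(2)] have "lp_norm p ((Bi * Mi) *\<^sub>v v) \<le> 2 * lp_norm p (Mi *\<^sub>v v)"
      using carr by (intro lp_norm_le_twice[OF p, where n = n]) (simp_all only: carrier_vecD)
    also have "lp_norm p (Mi *\<^sub>v v) \<le> lp_opnorm p Mi"
      unfolding lp_opnorm_def using Mi v bdd_above_lp_norm_image[OF p Mi(1)]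
      by (intro cSUP_upper) auto
    finally show ?thesis by simp
  qed
  \<comment> \<open>The unit ball must be nonempty for a bound on all values to pass to the
    supremum.\<close>
  moreover have "0\<^sub>v n \<in> {v \<in> carrier_vec n. lp_norm p v \<le> 1}"
    using lp_norm_zero[OF p] by simp
  ultimately show "lp_opnorm p (inverse_mat (M * B)) \<le> 2 * lp_opnorm p (inverse_mat M)"
    unfolding eq lp_opnorm_def[of p "Bi * Mi"] using Mi
    by (intro cSUP_least) (auto intro: zero_carrier_vec)
qed

section \<open>Lagrange expansion and comparison of the matrices\<close>

lemma differential_operator_sum:
  assumes L: "differential_operator k L" and T: "finite T"
    and f: "\<And>t. t \<in> T \<Longrightarrow> f t \<in> C_k_sphere k" and h: "h \<in> C_k_sphere k"
    and eq: "\<And>y. y \<in> S2 \<Longrightarrow> h y = (\<Sum>t\<in>T. c t * f t y)" and x: "x \<in> S2"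
  shows "L h x = (\<Sum>t\<in>T. c t * L (f t) x)"
  using T f h eq
proof (induction T arbitrary: h)
  case empty
  \<comment> \<open>Here \<open>h\<close> vanishes on the sphere, so \<open>h = 1 * h + h\<close>
    there, and linearity gives \<open>L h x = L h x + L h x\<close>.\<close>
  from differential_operator_linear[OF L empty.prems(2) empty.prems(2) empty.prems(2), of 1 x] empty.prems(3) x
  show ?case by simp
next
  case (insert t T)
  define g where "g y = (\<Sum>t\<in>T. c t * f t y)" for y
  have g: "g \<in> C_k_sphere k"
    using insert.prems(1) unfolding C_k_sphere_def g_def comp_def
    by (auto intro!: C_k_sum C_k_mult)
  have "L h x = c t * L (f t) x + L g x"
    using insert.prems insert.hyps g x
    by (intro differential_operator_linear[OF L]) (auto simp: g_def)
  also have "L g x = (\<Sum>t\<in>T. c t * L (f t) x)"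
    using insert.prems(1) by (intro insert.IH[OF _ g]) (auto simp: g_def)
  finally show ?case using insert.hyps by simp
qed

lemma tps_commute: "tps m x y = tps m y x"
  by (simp add: tps_def inner_commute)

lemma sph_sum_mem: "sph_sum n b \<in> Pi_space n"
  by (simp add: Pi_space_def)

lemma sph_sum_diff_sum:
  "sph_sum n (\<lambda>l \<mu>. b l \<mu> - (\<Sum>x\<in>T. c x * B x l \<mu>)) y =
     sph_sum n b y - (\<Sum>x\<in>T. c x * sph_sum n (B x) y)"
proof -
  have "(\<Sum>x\<in>T. c x * sph_sum n (B x) y) =
    (\<Sum>i\<in>(SIGMA l:{..n}. {- int l..int l}). \<Sum>x\<in>T. c x * B x (fst i) (snd i) * sph_harm (fst i) (snd i) y)"
    unfolding sph_sum_conv_Sigma sum_distrib_left by (subst sum.swap) (simp add: mult.assoc)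
  then show ?thesis
    unfolding sph_sum_conv_Sigma
    by (simp add: algebra_simps sum_subtractf sum_distrib_right sum_distrib_left)
qed

lemma spline_diff_sum:
  "spline m X (\<lambda>z. a z - (\<Sum>x\<in>T. c x * A x z)) (\<lambda>l \<mu>. b l \<mu> - (\<Sum>x\<in>T. c x * B x l \<mu>)) y =
     spline m X a b y - (\<Sum>x\<in>T. c x * spline m X (A x) (B x) y)"
proof -
  have "(\<Sum>z\<in>X. (\<Sum>x\<in>T. c x * A x z) * tps m y z) = (\<Sum>x\<in>T. c x * (\<Sum>z\<in>X. A x z * tps m y z))"
    unfolding sum_distrib_left sum_distrib_right by (subst sum.swap) (simp add: mult.assoc)
  then show ?thesis
    by (simp add: spline_def sph_sum_diff_sum algebra_simps sum_subtractf sum.distrib)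
qed

lemma moment_conditions_diff_sum:
  assumes "moment_conditions m X a" "\<And>x. x \<in> T \<Longrightarrow> moment_conditions m X (A x)"
  shows "moment_conditions m X (\<lambda>z. a z - (\<Sum>x\<in>T. c x * A x z))"
  unfolding moment_conditions_def
proof
  fix P assume P: "P \<in> Pi_space (m - 1)"
  have "(\<Sum>z\<in>X. (\<Sum>x\<in>T. c x * A x z) * P z) = (\<Sum>x\<in>T. c x * (\<Sum>z\<in>X. A x z * P z))"
    unfolding sum_distrib_left sum_distrib_right by (subst sum.swap) (simp add: mult.assoc)
  also have "\<dots> = 0" using assms(2) P by (simp add: moment_conditions_def)
  finally show "(\<Sum>z\<in>X. (a z - (\<Sum>x\<in>T. c x * A x z)) * P z) = 0"
    using assms(1) P by (simp add: moment_conditions_def left_diff_distrib sum_subtractf)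
qed

text \<open>
  The interpolation system is symmetric, so solvability for all cardinal data forces a kernel
  element to have vanishing kernel coefficients: pair it with the Lagrange functions.
\<close>

lemma interpolation_kernel:
  assumes X: "finite X" and full: "full_lagrange m X A B"
    and mom: "moment_conditions m X a" and zero: "\<And>y. y \<in> X \<Longrightarrow> spline m X a b y = 0"
    and x: "x \<in> X"
  shows "a x = 0" "sph_sum (m - 1) b x = 0"
proof -
  have a0: "a x = 0" if x: "x \<in> X" for x
  proof -
    have momA: "moment_conditions m X (A x)"
      and val: "\<And>y. y \<in> X \<Longrightarrow> spline m X (A x) (B x) y = (if y = x then 1 else 0)"
      using full x by (auto simp: full_lagrange_def lagrange_coeffs_def)
    have "a x = (\<Sum>y\<in>X. a y * spline m X (A x) (B x) y)"
      using X x by (simp add: val if_distrib cong: if_cong)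
    also have "\<dots> = (\<Sum>y\<in>X. \<Sum>z\<in>X. a y * (A x z * tps m y z)) + (\<Sum>y\<in>X. a y * sph_sum (m - 1) (B x) y)"
      by (simp add: spline_def distrib_left sum.distrib sum_distrib_left)
    also have "(\<Sum>y\<in>X. a y * sph_sum (m - 1) (B x) y) = 0"
      using mom sph_sum_mem by (auto simp: moment_conditions_def)
    also have "(\<Sum>y\<in>X. \<Sum>z\<in>X. a y * (A x z * tps m y z)) = (\<Sum>z\<in>X. A x z * (\<Sum>y\<in>X. a y * tps m z y))"
      by (subst sum.swap) (simp add: sum_distrib_left tps_commute mult.left_commute)
    \<comment> \<open>Since the spline vanishes at the nodes, its kernel part there is minus its
      harmonic part, which the moment conditions on \<open>A x\<close> annihilate.\<close>
    also have "\<dots> = (\<Sum>z\<in>X. A x z * (- sph_sum (m - 1) b z))"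
    proof (intro sum.cong refl)
      fix z assume "z \<in> X"
      from zero[OF this] have "(\<Sum>y\<in>X. a y * tps m z y) = - sph_sum (m - 1) b z"
        by (simp add: spline_def)
      then show "A x z * (\<Sum>y\<in>X. a y * tps m z y) = A x z * (- sph_sum (m - 1) b z)"
        by (simp only:)
    qed
    also have "\<dots> = - (\<Sum>z\<in>X. A x z * sph_sum (m - 1) b z)" by (simp add: sum_negf)
    also have "\<dots> = 0" using momA sph_sum_mem by (auto simp: moment_conditions_def)
    finally show ?thesis by simp
  qed
  show "a x = 0" using a0[OF x] .
  show "sph_sum (m - 1) b x = 0" using zero[OF x] a0 by (simp add: spline_def)
qed

text \<open>A spline minus its expansion is again a spline satisfying the moment conditions, and it
  vanishes at the nodes. By \<open>interpolation_kernel\<close> its kernel coefficients vanish and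
  its harmonic part is zero on \<open>X\<close>; unisolvence carries this to the sphere.\<close>

lemma spline_lagrange_expansion:
  assumes X: "finite X" and full: "full_lagrange m X A B"
    and unisolvent: "\<And>b. (\<And>y. y \<in> X \<Longrightarrow> sph_sum (m - 1) b y = 0) \<Longrightarrow> (\<And>y. y \<in> S2 \<Longrightarrow> sph_sum (m - 1) b y = 0)"
    and mom: "moment_conditions m X a" and y: "y \<in> S2"
  shows "spline m X a b y = (\<Sum>x\<in>X. spline m X a b x * spline m X (A x) (B x) y)"
proof -
  let ?c = "spline m X a b"
  define a' where "a' z = a z - (\<Sum>x\<in>X. ?c x * A x z)" for z
  define b' where "b' l \<mu> = b l \<mu> - (\<Sum>x\<in>X. ?c x * B x l \<mu>)" for l \<mu>
  have s: "spline m X a' b' y = ?c y - (\<Sum>x\<in>X. ?c x * spline m X (A x) (B x) y)" for y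
    unfolding a'_def b'_def by (rule spline_diff_sum)
  have "moment_conditions m X a'"
    unfolding a'_def using full mom
    by (intro moment_conditions_diff_sum) (auto simp: full_lagrange_def lagrange_coeffs_def)
  moreover have "spline m X a' b' z = 0" if "z \<in> X" for z
  proof -
    have "(\<Sum>x\<in>X. ?c x * spline m X (A x) (B x) z) = (\<Sum>x\<in>X. if z = x then ?c x else 0)"
      using full that by (intro sum.cong) (auto simp: full_lagrange_def lagrange_coeffs_def)
    then show ?thesis using X that by (simp add: s)
  qed
  ultimately have "\<And>z. z \<in> X \<Longrightarrow> a' z = 0" "\<And>z. z \<in> X \<Longrightarrow> sph_sum (m - 1) b' z = 0"
    using interpolation_kernel[OF X full] by blast+
  then have "spline m X a' b' y = 0"
    using unisolvent y by (simp add: spline_def)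
  then show ?thesis by (simp add: s)
qed

text \<open>This is the inclusion of the local spline space in the full one: coefficients are zero
  off the footprint, so the two moment sums agree.\<close>

lemma local_lagrange_moment_conditions:
  assumes X: "finite X" and loc: "local_lagrange m K X A B" and x: "x \<in> X"
  shows "moment_conditions m X (A x)"
proof -
  have "(\<Sum>z\<in>X. A x z * P z) = (\<Sum>z\<in>footprint K X x. A x z * P z)" for P
    using X loc x by (intro sum.mono_neutral_right) (auto simp: local_lagrange_def footprint_def)
  then show ?thesis
    using loc x by (simp add: local_lagrange_def lagrange_coeffs_def moment_conditions_def)
qed

section \<open>Uniform bounds on kernel, harmonics and spline differences\<close>

lemma tps_bounded: "m \<ge> 2 \<Longrightarrow> \<exists>T. \<forall>x\<in>S2. \<forall>y\<in>S2. \<bar>tps m x y\<bar> \<le> T"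
proof -
  assume "m \<ge> 2"
  then obtain k where k: "m - 1 = Suc k" by (cases "m - 1") auto
  have "continuous_on {0..2} (\<lambda>s::real. s ^ Suc k * ln s)"
    by (intro continuous_at_imp_continuous_on ballI continuous_power_ln)
  then have "bounded ((\<lambda>s::real. s ^ Suc k * ln s) ` {0..2})"
    by (intro compact_imp_bounded compact_continuous_image) auto
  then obtain T where T: "\<And>s::real. s \<in> {0..2} \<Longrightarrow> \<bar>s ^ Suc k * ln s\<bar> \<le> T"
    unfolding bounded_iff by fastforce
  have "\<bar>tps m x y\<bar> \<le> T" if "x \<in> S2" "y \<in> S2" for x y
    using T[of "1 - x \<bullet> y"] S2_inner_bounds[OF that] unfolding tps_def tps_phi_def k by simp
  then show ?thesis by blast
qed

lemma sph_harm_bounded: "\<exists>Q. \<forall>l\<le>n. \<forall>\<mu>\<in>{- int l..int l}. \<forall>y\<in>S2. \<bar>sph_harm l \<mu> y\<bar> \<le> Q"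
proof -
  have "bounded (\<Union>i\<in>(SIGMA l:{..n}. {- int l..int l}). sph_harm (fst i) (snd i) ` S2)"
    by (intro bounded_UN finite_SigmaI ballI compact_imp_bounded compact_continuous_image
        continuous_on_sph_harm) auto
  then obtain Q where "\<forall>z\<in>(\<Union>i\<in>(SIGMA l:{..n}. {- int l..int l}). sph_harm (fst i) (snd i) ` S2). \<bar>z\<bar> \<le> Q"
    by (auto simp: bounded_iff)
  then show ?thesis by (intro exI[of _ Q]) fastforce
qed

text \<open>Absolute sums of coefficient errors are paired with sup bounds on the basis functions.
  The two sums are those of \<open>local_coefficient_error\<close>, so no count of nodes enters
  here.\<close>

lemma spline_diff_le:
  assumes T: "\<And>z. z \<in> X \<Longrightarrow> \<bar>tps m y z\<bar> \<le> T" "0 \<le> T"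
    and Q: "\<And>l \<mu>. l \<le> m - 1 \<Longrightarrow> \<mu> \<in> {- int l..int l} \<Longrightarrow> \<bar>sph_harm l \<mu> y\<bar> \<le> Q" "0 \<le> Q"
    and a: "(\<Sum>z\<in>X. \<bar>a z - a' z\<bar>) \<le> \<epsilon>"
    and b: "(\<Sum>l\<le>m - 1. \<Sum>\<mu>\<in>{- int l..int l}. \<bar>b l \<mu> - b' l \<mu>\<bar>) \<le> \<epsilon>"
  shows "\<bar>spline m X a b y - spline m X a' b' y\<bar> \<le> (T + Q) * \<epsilon>"
proof -
  have "spline m X a b y - spline m X a' b' y =
    (\<Sum>z\<in>X. (a z - a' z) * tps m y z) +
    (\<Sum>l\<le>m - 1. \<Sum>\<mu>\<in>{- int l..int l}. (b l \<mu> - b' l \<mu>) * sph_harm l \<mu> y)"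
    by (simp add: spline_def sph_sum_def left_diff_distrib sum_subtractf)
  moreover have "\<bar>\<Sum>z\<in>X. (a z - a' z) * tps m y z\<bar> \<le> (\<Sum>z\<in>X. \<bar>a z - a' z\<bar>) * T"
    unfolding sum_distrib_right using T
    by (intro order_trans[OF sum_abs sum_mono]) (auto simp: abs_mult mult_left_mono)
  moreover have "\<bar>\<Sum>l\<le>m - 1. \<Sum>\<mu>\<in>{- int l..int l}. (b l \<mu> - b' l \<mu>) * sph_harm l \<mu> y\<bar> \<le>
     (\<Sum>l\<le>m - 1. \<Sum>\<mu>\<in>{- int l..int l}. \<bar>b l \<mu> - b' l \<mu>\<bar>) * Q"
    unfolding sum_distrib_right using Q
    by (intro order_trans[OF sum_abs sum_mono] order_trans[OF sum_abs sum_mono])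
      (auto simp: abs_mult mult_left_mono)
  moreover have "(\<Sum>z\<in>X. \<bar>a z - a' z\<bar>) * T \<le> \<epsilon> * T" using a T(2) by (rule mult_right_mono)
  moreover have "(\<Sum>l\<le>m - 1. \<Sum>\<mu>\<in>{- int l..int l}. \<bar>b l \<mu> - b' l \<mu>\<bar>) * Q \<le> \<epsilon> * Q"
    using b Q(2) by (rule mult_right_mono)
  ultimately show ?thesis by (simp add: algebra_simps)
qed

lemma fd_matrix_local_eq_mult:
  assumes L: "differential_operator k L" and k: "k < m - 1"
    and xs: "distinct xs" "set xs \<subseteq> S2"
    and full: "full_lagrange m (set xs) A B" and loc: "local_lagrange m K (set xs) A' B'"
    and unisolvent: "\<And>b. (\<And>y. y \<in> set xs \<Longrightarrow> sph_sum (m - 1) b y = 0) \<Longrightarrow> (\<And>y. y \<in> S2 \<Longrightarrow> sph_sum (m - 1) b y = 0)"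
  shows "fd_matrix L xs (\<lambda>x. spline m (set xs) (A' x) (B' x)) =
    fd_matrix L xs (\<lambda>x. spline m (set xs) (A x) (B x)) *
    Matrix.mat (length xs) (length xs) (\<lambda>(i, j). spline m (set xs) (A' (xs ! j)) (B' (xs ! j)) (xs ! i))"
    (is "?M' = ?M * ?B")
proof (rule eq_matI)
  fix i j assume "i < dim_row (?M * ?B)" "j < dim_col (?M * ?B)"
  then have ij: "i < length xs" "j < length xs" by (auto simp: fd_matrix_def)
  then have mem: "xs ! i \<in> S2" "xs ! j \<in> set xs" using subsetD[OF xs(2)] by auto
  let ?s = "spline m (set xs) (A' (xs ! j)) (B' (xs ! j))"
  let ?\<chi> = "\<lambda>x. spline m (set xs) (A x) (B x)"
  have "?M' $$ (i, j) = L ?s (xs ! i)" using ij by (simp add: fd_matrix_def)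
  also have "\<dots> = (\<Sum>x\<in>set xs. ?s x * L (?\<chi> x) (xs ! i))"
    using spline_lagrange_expansion[OF _ full unisolvent
        local_lagrange_moment_conditions[OF _ loc mem(2)]] k mem(1)
    by (intro differential_operator_sum[OF L]) (auto intro: spline_in_C_k_sphere)
  also have "\<dots> = (\<Sum>k<length xs. ?s (xs ! k) * L (?\<chi> (xs ! k)) (xs ! i))"
    using xs(1) by (intro sum.reindex_bij_betw[symmetric] bij_betw_nth) auto
  also have "\<dots> = (?M * ?B) $$ (i, j)"
    using ij by (simp add: fd_matrix_def scalar_prod_def lessThan_atLeast0 mult.commute)
  finally show "?M' $$ (i, j) = (?M * ?B) $$ (i, j)" .
qed (auto simp: fd_matrix_def)

theorem theorem5p5:
  fixes m m0 :: nat
    and \<rho> K \<nu> \<kappa> :: real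
    and L :: "(real ^ 3 \<Rightarrow> real) \<Rightarrow> real ^ 3 \<Rightarrow> real"
    and p :: ereal
  assumes "m \<ge> 2"
    and "m0 < m - 1"
    and "differential_operator m0 L"
    and "K > 0"
    and "\<nu> > 0"
    and "full_coefficient_decay m \<rho> \<nu>"
    and "local_coefficient_error m \<rho> K \<nu> \<kappa>"
    and "K * \<nu> > 2 + \<kappa>"
    and "1 \<le> p"
  shows "\<exists>h0>0. \<forall>xs A B A' B'.
    distinct xs \<and> quasi_uniform \<rho> (set xs) \<and> fill_distance (set xs) \<le> h0 \<and>
    full_lagrange m (set xs) A B \<and> local_lagrange m K (set xs) A' B' \<longrightarrow>
    (let M = fd_matrix L xs (\<lambda>x. spline m (set xs) (A x) (B x));
         M' = fd_matrix L xs (\<lambda>x. spline m (set xs) (A' x) (B' x))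
     in invertible_mat M \<longrightarrow>
          invertible_mat M' \<and>
          lp_opnorm p (inverse_mat M') \<le> 2 * lp_opnorm p (inverse_mat M))"
proof -
  obtain \<delta> where \<delta>: "\<delta> > 0" and uni: "\<And>X b y. finite X \<Longrightarrow> X \<noteq> {} \<Longrightarrow> X \<subseteq> S2 \<Longrightarrow>
      fill_distance X < \<delta> \<Longrightarrow> (\<And>y. y \<in> X \<Longrightarrow> sph_sum (m - 1) b y = 0) \<Longrightarrow> y \<in> S2 \<Longrightarrow> sph_sum (m - 1) b y = 0"
  proof -
    from sph_sum_unisolvent[of "m - 1"] obtain \<delta> where "\<delta> > 0" and
      "\<forall>X b. finite X \<and> X \<noteq> {} \<and> X \<subseteq> S2 \<and> fill_distance X < \<delta> \<and>
        (\<forall>y\<in>X. sph_sum (m - 1) b y = 0) \<longrightarrow> (\<forall>y\<in>S2. sph_sum (m - 1) b y = 0)"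
      by (elim exE conjE)
    then show ?thesis by (intro that[of \<delta>]) (assumption, blast)
  qed
  obtain T0 where T0: "\<And>x y. x \<in> S2 \<Longrightarrow> y \<in> S2 \<Longrightarrow> \<bar>tps m x y\<bar> \<le> T0"
    using tps_bounded[OF assms(1)] by blast
  obtain Q0 where Q0: "\<And>l \<mu> y. l \<le> m - 1 \<Longrightarrow> \<mu> \<in> {- int l..int l} \<Longrightarrow> y \<in> S2 \<Longrightarrow> \<bar>sph_harm l \<mu> y\<bar> \<le> Q0"
    using sph_harm_bounded[of "m - 1"] by blast
  \<comment> \<open>The maximum with \<open>0\<close> makes both bounds nonnegative, so that
    inequalities can be multiplied by them.\<close>
  define T Q where "T = max 0 T0" and "Q = max 0 Q0"
  obtain C h1 where h1: "h1 > 0" and err: "\<And>X A B A' B' x.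
      quasi_uniform \<rho> X \<Longrightarrow> fill_distance X \<le> h1 \<Longrightarrow> full_lagrange m X A B \<Longrightarrow>
      local_lagrange m K X A' B' \<Longrightarrow> x \<in> X \<Longrightarrow>
      (\<Sum>y\<in>X. \<bar>A x y - A' x y\<bar>) \<le> C * fill_distance X powr (K * \<nu> - \<kappa>) \<and>
      (\<Sum>l\<le>m - 1. \<Sum>\<mu>\<in>{- int l..int l}. \<bar>B x l \<mu> - B' x l \<mu>\<bar>)
              \<le> C * fill_distance X powr (K * \<nu> - \<kappa>)"
  proof -
    from assms(7)[unfolded local_coefficient_error_def] obtain C h1 where "h1 > 0" and
      "\<forall>X A B A' B'.
         quasi_uniform \<rho> X \<and> fill_distance X \<le> h1 \<and>
         full_lagrange m X A B \<and> local_lagrange m K X A' B' \<longrightarrow>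
         (\<forall>x\<in>X.
            (\<Sum>y\<in>X. \<bar>A x y - A' x y\<bar>) \<le> C * fill_distance X powr (K * \<nu> - \<kappa>) \<and>
            (\<Sum>l\<le>m - 1. \<Sum>\<mu>\<in>{- int l..int l}. \<bar>B x l \<mu> - B' x l \<mu>\<bar>)
              \<le> C * fill_distance X powr (K * \<nu> - \<kappa>))"
      by (elim exE conjE)
    then show ?thesis by (intro that[of h1 C]) (assumption, simp)
  qed
  \<comment> \<open>This is what remains of the exponent after two powers of \<open>h\<close> are
    spent on the number of points.\<close>
  define e where "e = K * \<nu> - \<kappa> - 2"
  have e: "e > 0" using assms(8) by (simp add: e_def)
  \<comment> \<open>The factor \<open>64 * \<rho>\<^sup>2\<close> is twice the constant of
    \<open>card_le_fill_distance\<close>, so \<open>D * h powr e\<close> bounds \<open>2 * n\<close>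
    times the entry error. The modulus is taken because \<open>C\<close> may have any sign.\<close>
  define D where "D = 64 * \<rho>\<^sup>2 * ((T + Q) * \<bar>C\<bar>)"
  have "((\<lambda>h. D * h powr e) \<longlongrightarrow> D * 0) (at_right 0)"
    using e by (intro tendsto_mult_left) real_asymp
  then have "\<forall>\<^sub>F h in at_right 0. D * h powr e < 1"
    by (rule order_tendstoD) simp
  then obtain h2 where h2: "h2 > 0" "\<And>h. 0 < h \<Longrightarrow> h < h2 \<Longrightarrow> D * h powr e < 1"
    by (auto simp: eventually_at_right_field)
  \<comment> \<open>Halving \<open>\<delta>\<close> and \<open>h2\<close> turns
    \<open>\<le> h0\<close> into the strict inequalities demanded by these two thresholds.\<close>
  define h0 where "h0 = Min {\<delta> / 2, h1, h2 / 2}"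
  have h0: "h0 > 0" "h0 < \<delta>" "h0 \<le> h1" "h0 < h2"
    using \<delta> h1 h2(1) by (auto simp: h0_def min_def)
  have main: "invertible_mat (fd_matrix L xs (\<lambda>x. spline m (set xs) (A' x) (B' x))) \<and>
      lp_opnorm p (inverse_mat (fd_matrix L xs (\<lambda>x. spline m (set xs) (A' x) (B' x))))
      \<le> 2 * lp_opnorm p (inverse_mat (fd_matrix L xs (\<lambda>x. spline m (set xs) (A x) (B x))))"
    if xs: "distinct xs" and qu: "quasi_uniform \<rho> (set xs)" and fill: "fill_distance (set xs) \<le> h0"
      and full: "full_lagrange m (set xs) A B" and loc: "local_lagrange m K (set xs) A' B'"
      and inv: "invertible_mat (fd_matrix L xs (\<lambda>x. spline m (set xs) (A x) (B x)))"
    for xs A B A' B'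
  proof -
    define n where "n = length xs"
    define h where "h = fill_distance (set xs)"
    have X: "finite (set xs)" "set xs \<noteq> {}" "set xs \<subseteq> S2"
      using qu by (auto simp: quasi_uniform_def)
    have h: "0 < h" "h < h2" using fill_distance_pos[OF X] fill h0 by (auto simp: h_def)
    have n: "real n * h\<^sup>2 \<le> 32 * \<rho>\<^sup>2"
      using card_le_fill_distance[OF qu] xs by (simp add: n_def h_def distinct_card)
    define \<epsilon> where "\<epsilon> = (T + Q) * (\<bar>C\<bar> * h powr (K * \<nu> - \<kappa>))"
    have "h powr (K * \<nu> - \<kappa>) = h\<^sup>2 * h powr e"
      using h(1) by (simp add: e_def powr_diff powr_numeral)
    then have "2 * real n * \<epsilon> = (real n * h\<^sup>2) * (2 * ((T + Q) * \<bar>C\<bar>) * h powr e)"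
      by (simp add: \<epsilon>_def)
    also have "\<dots> \<le> 32 * \<rho>\<^sup>2 * (2 * ((T + Q) * \<bar>C\<bar>) * h powr e)"
      using n by (intro mult_right_mono mult_nonneg_nonneg) (auto simp: T_def Q_def)
    also have "\<dots> = D * h powr e" by (simp add: D_def)
    also have "\<dots> < 1" using h2(2)[OF h] .
    finally have n\<epsilon>: "2 * real n * \<epsilon> \<le> 1" by simp
    let ?B = "Matrix.mat n n (\<lambda>(i, j). spline m (set xs) (A' (xs ! j)) (B' (xs ! j)) (xs ! i))"
    have near: "\<bar>?B $$ (i, j) - (if i = j then 1 else 0)\<bar> \<le> 1 / (2 * real n)" if ij: "i < n" "j < n" for i j
    proof -
      have mem: "xs ! i \<in> set xs" "xs ! j \<in> set xs" using ij by (auto simp: n_def)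
      \<comment> \<open>The identity matrix holds the nodal values of the full Lagrange functions,
        so \<open>?B\<close> minus it has the entries
        \<open>b\<^sub>j x\<^sub>i - \<chi>\<^sub>j x\<^sub>i\<close>, which the coefficient errors
        control.\<close>
      have "(if i = j then 1 else 0) = spline m (set xs) (A (xs ! j)) (B (xs ! j)) (xs ! i)"
        using full mem xs ij by (auto simp: full_lagrange_def lagrange_coeffs_def nth_eq_iff_index_eq n_def)
      then have "\<bar>?B $$ (i, j) - (if i = j then 1 else 0)\<bar> =
          \<bar>spline m (set xs) (A (xs ! j)) (B (xs ! j)) (xs ! i) - spline m (set xs) (A' (xs ! j)) (B' (xs ! j)) (xs ! i)\<bar>"
        using ij by (simp add: abs_minus_commute)
      also have "\<dots> \<le> \<epsilon>"
        unfolding \<epsilon>_def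
      proof (rule spline_diff_le)
        fix z assume "z \<in> set xs"
        then show "\<bar>tps m (xs ! i) z\<bar> \<le> T" using T0[OF subsetD[OF X(3) mem(1)] subsetD[OF X(3)], of z]
          by (simp add: T_def le_max_iff_disj)
      next
        fix l \<mu> assume "l \<le> m - 1" "\<mu> \<in> {- int l..int l}"
        then show "\<bar>sph_harm l \<mu> (xs ! i)\<bar> \<le> Q" using Q0[OF _ _ subsetD[OF X(3) mem(1)], of l \<mu>]
          by (simp add: Q_def le_max_iff_disj)
      next
        have le: "C * h powr (K * \<nu> - \<kappa>) \<le> \<bar>C\<bar> * h powr (K * \<nu> - \<kappa>)"
          by (intro mult_right_mono) auto
        note err = err[OF qu order_trans[OF fill h0(3)] full loc mem(2), folded h_def]
        show "(\<Sum>z\<in>set xs. \<bar>A (xs ! j) z - A' (xs ! j) z\<bar>) \<le> \<bar>C\<bar> * h powr (K * \<nu> - \<kappa>)"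
          using err le by linarith
        show "(\<Sum>l\<le>m - 1. \<Sum>\<mu>\<in>{- int l..int l}. \<bar>B (xs ! j) l \<mu> - B' (xs ! j) l \<mu>\<bar>)
            \<le> \<bar>C\<bar> * h powr (K * \<nu> - \<kappa>)"
          using err le by linarith
      qed (auto simp: T_def Q_def)
      also have "\<epsilon> \<le> 1 / (2 * real n)" using n\<epsilon> ij by (simp add: field_simps)
      finally show ?thesis .
    qed
    have uni': "sph_sum (m - 1) b y = 0" if "\<And>y. y \<in> set xs \<Longrightarrow> sph_sum (m - 1) b y = 0" "y \<in> S2" for b y
      using uni[OF X _ that] fill h0(2) by simp
    have M: "fd_matrix L xs (\<lambda>x. spline m (set xs) (A x) (B x)) \<in> carrier_mat n n"
      by (simp add: fd_matrix_def n_def)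
    have eq: "fd_matrix L xs (\<lambda>x. spline m (set xs) (A' x) (B' x)) =
        fd_matrix L xs (\<lambda>x. spline m (set xs) (A x) (B x)) * ?B"
      unfolding n_def using uni' by (rule fd_matrix_local_eq_mult[OF assms(3,2) xs X(3) full loc])
    show ?thesis
      unfolding eq using lp_opnorm_inverse_mult_le[OF assms(9) M _ near inv] by simp
  qed
  show ?thesis
    unfolding Let_def using h0(1) main by blast
qed

end
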